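(* For each integer $n\ge 1$ there exist matrices $H,H_0\in\mathfrak{sl}(n+1,\mathbb{C})$, where $H_0=\mathrm{Diag}(n,-1,\ldots,-1)$ is the element whose adjoint orbit is the minimal orbit $\mathcal{O}_n$ and $H$ is a regular real diagonal matrix, and a constant $c\in\mathbb{C}$, such that the Landau--Ginzburg models $(\mathcal{O}_n,f_H)$ and $(T^*\mathbb{P}^n,h_c)$ are birationally equivalent.
   Context: A Landau--Ginzburg model is a pair $(X,w)$ formed by a variety $X$ (over $\mathbb{C}$) and a function $w$ on $X$, holomorphic to $\mathbb{C}$ (or, more generally, rational to $\mathbb{P}^1$), called the superpotential or potential. Two Landau--Ginzburg models are birationally equivalent if their domains are birationally equivalent varieties and their potentials coincide on Zariski open sets; that is, $(X,w)$ and $(X',w')$ are birationally equivalent if there are dense Zariski open subsets $U\subset X$, $U'\subset X'$ and an isomorphism of varieties $\varphi\colon U\to U'$ with $w|_U=w'|_{U'}\circ\varphi$. Minimal orbit. $\mathcal{O}_n=\{gH_0g^{-1}: g\in \mathrm{SL}(n+1,\mathbb{C})\}\subset\mathfrak{sl}(n+1,\mathbb{C})$ is the adjoint orbit of $H_0=\mathrm{Diag}(n,-1,\ldots,-1)$. Height function. A diagonal matrix $H=\mathrm{Diag}(\lambda_1,\ldots,\lambda_{n+1})\in\mathfrak{sl}(n+1,\mathbb{C})$ is regular if the $\lambda_i$ are pairwise distinct. For $H$ regular with real entries, $f_H\colon\mathcal{O}_n\to\mathbb{C}$ is the height function $f_H(A)=\langle H,A\rangle$, with the invariant form normalized as $\langle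 A,B\rangle=\mathrm{tr}(AB)$. Toric potential. On $T^*\mathbb{P}^n$ (total space of the holomorphic cotangent bundle) let $V_0=\{x_0\neq 0\}$ be the open chart with coordinates $([1,x_1,\ldots,x_n],(y_1,\ldots,y_n))$, where $y_i$ are the fibre coordinates dual to $x_i$. For $c\in\mathbb{C}$, $h_c\colon T^*\mathbb{P}^n\to\mathbb{C}$ is the regular function, called toric potential, whose expression on $V_0$ is $c-\sum_{i=1}^n 2i\,x_iy_i$. It is associated with the Hamiltonian $\mathbb{C}^*$-action $t\cdot([1,x_1,\ldots,x_n],(y_1,\ldots,y_n))=([1,t^{-1}x_1,\ldots,t^{-n}x_n],(ty_1,\ldots,t^ny_n))$. *)

theory Defs
  imports "HOL-Analysis.Analysis" "Jordan_Normal_Form.Determinant"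
begin

section \<open>Varieties over the complex numbers as spaces with functions\<close>

text \<open>
  A space with functions is a topological space together with, for every open set, a set of
  complex-valued functions. The functions are total in HOL; only their values on the
  open set in question matter (this is part of \<open>function_sheaf\<close> below).
\<close>

record 'a fspace =
  zar :: "'a topology"
  reg :: "'a set \<Rightarrow> ('a \<Rightarrow> complex) set"

abbreviation points :: "'a fspace \<Rightarrow> 'a set" where
  "points X \<equiv> topspace (zar X)"

definition open_subspace :: "'a fspace \<Rightarrow> 'a set \<Rightarrow> 'a fspace" where
  "open_subspace X U = \<lparr>zar = subtopology (zar X) U, reg = reg X\<rparr>"

definition function_sheaf :: "'a fspace \<Rightarrow> bool" where
  "function_sheaf X \<longleftrightarrow>
     (\<forall>U V f. openin (zar X) U \<and> openin (zar X) V \<and> V \<subseteq> U \<and> f \<in> reg X U \<longrightarrow> f \<in> reg X V) \<and>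
     (\<forall>U f. openin (zar X) U \<and>
        (\<forall>p\<in>U. \<exists>V g. openin (zar X) V \<and> p \<in> V \<and> V \<subseteq> U \<and> g \<in> reg X V \<and> (\<forall>q\<in>V. f q = g q))
        \<longrightarrow> f \<in> reg X U)"

definition morphism :: "'a fspace \<Rightarrow> 'b fspace \<Rightarrow> ('a \<Rightarrow> 'b) \<Rightarrow> bool" where
  "morphism X Y \<phi> \<longleftrightarrow> continuous_map (zar X) (zar Y) \<phi> \<and>
     (\<forall>V. openin (zar Y) V \<longrightarrow> (\<forall>f\<in>reg Y V. f \<circ> \<phi> \<in> reg X {p \<in> points X. \<phi> p \<in> V}))"

definition isomorphism :: "'a fspace \<Rightarrow> 'b fspace \<Rightarrow> ('a \<Rightarrow> 'b) \<Rightarrow> bool" where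
  "isomorphism X Y \<phi> \<longleftrightarrow> morphism X Y \<phi> \<and>
     (\<exists>\<psi>. morphism Y X \<psi> \<and> (\<forall>p\<in>points X. \<psi> (\<phi> p) = p) \<and> (\<forall>q\<in>points Y. \<phi> (\<psi> q) = q))"

text \<open>
  Polynomial functions in a given family \<open>C\<close> of coordinate functions, and the structure which a
  set \<open>X\<close> inherits from the affine space with these coordinates: the Zariski topology, generated by
  the principal open sets, and the functions that are locally quotients of polynomials.
\<close>

inductive_set polynomials :: "('a \<Rightarrow> complex) set \<Rightarrow> ('a \<Rightarrow> complex) set"
  for C :: "('a \<Rightarrow> complex) set" where
  const: "(\<lambda>_. a) \<in> polynomials C"
| coord: "c \<in> C \<Longrightarrow> c \<in> polynomials C"
| add: "p \<in> polynomials C \<Longrightarrow> q \<in> polynomials C \<Longrightarrow> (\<lambda>z. p z + q z) \<in> polynomials C"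
| mult: "p \<in> polynomials C \<Longrightarrow> q \<in> polynomials C \<Longrightarrow> (\<lambda>z. p z * q z) \<in> polynomials C"

definition zariski_topology :: "('a \<Rightarrow> complex) set \<Rightarrow> 'a set \<Rightarrow> 'a topology" where
  "zariski_topology C X = topology_generated_by {{z \<in> X. p z \<noteq> 0} | p. p \<in> polynomials C}"

definition embedded_space :: "('a \<Rightarrow> complex) set \<Rightarrow> 'a set \<Rightarrow> 'a fspace" where
  "embedded_space C X = \<lparr>zar = zariski_topology C X,
     reg = (\<lambda>U. {f. \<forall>a\<in>U. \<exists>W. openin (zariski_topology C X) W \<and> a \<in> W \<and> W \<subseteq> U \<and>
       (\<exists>p\<in>polynomials C. \<exists>q\<in>polynomials C. \<forall>z\<in>W. q z \<noteq> 0 \<and> f z = p z / q z)})\<rparr>"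

text \<open>
  Points of the affine space with coordinates indexed by \<open>I\<close> are extensional functions on \<open>I\<close>.
\<close>

definition affine_points :: "nat set \<Rightarrow> (nat \<Rightarrow> complex) set" where
  "affine_points I = I \<rightarrow>\<^sub>E UNIV"

definition affine_coords :: "nat set \<Rightarrow> ((nat \<Rightarrow> complex) \<Rightarrow> complex) set" where
  "affine_coords I = {\<lambda>x. x i | i. i \<in> I}"

definition algebraic_subset :: "nat \<Rightarrow> (nat \<Rightarrow> complex) set \<Rightarrow> bool" where
  "algebraic_subset N Z \<longleftrightarrow>
     closedin (zariski_topology (affine_coords {..<N}) (affine_points {..<N})) Z"

definition affine_variety :: "'a fspace \<Rightarrow> bool" where
  "affine_variety X \<longleftrightarrow> (\<exists>N Z \<phi>. algebraic_subset N Z \<and>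
     isomorphism X (embedded_space (affine_coords {..<N}) Z) \<phi>)"

text \<open>
  Separatedness is taken in the form that any two morphisms from an affine variety agree on a closed
  set, which needs no product of prevarieties. Varieties are not required to be irreducible.
\<close>

definition separated :: "'a fspace \<Rightarrow> bool" where
  "separated X \<longleftrightarrow> (\<forall>N Z f g. algebraic_subset N Z \<longrightarrow>
     morphism (embedded_space (affine_coords {..<N}) Z) X f \<longrightarrow>
     morphism (embedded_space (affine_coords {..<N}) Z) X g \<longrightarrow>
     closedin (zariski_topology (affine_coords {..<N}) Z) {z \<in> Z. f z = g z})"

definition variety :: "'a fspace \<Rightarrow> bool" where
  "variety X \<longleftrightarrow> function_sheaf X \<and>
     (\<exists>\<U>. finite \<U> \<and> \<Union>\<U> = points X \<and>
        (\<forall>U\<in>\<U>. openin (zar X) U \<and> affine_variety (open_subspace X U))) \<and>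
     separated X"

section \<open>Landau--Ginzburg models\<close>

definition landau_ginzburg :: "'a fspace \<Rightarrow> ('a \<Rightarrow> complex) \<Rightarrow> bool" where
  "landau_ginzburg X w \<longleftrightarrow> variety X \<and> w \<in> reg X (points X)"

definition birationally_equivalent ::
    "'a fspace \<times> ('a \<Rightarrow> complex) \<Rightarrow> 'b fspace \<times> ('b \<Rightarrow> complex) \<Rightarrow> bool" where
  "birationally_equivalent = (\<lambda>(X, w) (X', w').
     landau_ginzburg X w \<and> landau_ginzburg X' w' \<and>
     (\<exists>U U' \<phi>. openin (zar X) U \<and> zar X closure_of U = points X \<and>
        openin (zar X') U' \<and> zar X' closure_of U' = points X' \<and>
        isomorphism (open_subspace X U) (open_subspace X' U') \<phi> \<and>
        (\<forall>p\<in>U. w p = w' (\<phi> p))))"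

section \<open>The minimal orbit and its height functions\<close>

definition mat_trace :: "complex mat \<Rightarrow> complex" where
  "mat_trace A = (\<Sum>i<dim_row A. A $$ (i, i))"

definition sl :: "nat \<Rightarrow> complex mat set" where
  "sl m = {A \<in> carrier_mat m m. mat_trace A = 0}"

definition adjoint_orbit :: "nat \<Rightarrow> complex mat \<Rightarrow> complex mat set" where
  "adjoint_orbit m B = {g * B * g' | g g'. g \<in> carrier_mat m m \<and> g' \<in> carrier_mat m m \<and>
     Determinant.det g = 1 \<and> g * g' = 1\<^sub>m m \<and> g' * g = 1\<^sub>m m}"

definition minimal_element :: "nat \<Rightarrow> complex mat" where
  "minimal_element n = mat_diag (n + 1) (\<lambda>i. if i = 0 then of_nat n else - 1)"

definition mat_coords :: "nat \<Rightarrow> (complex mat \<Rightarrow> complex) set" where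
  "mat_coords m = {\<lambda>A. A $$ (i, j) | i j. i < m \<and> j < m}"

definition orbit_variety :: "nat \<Rightarrow> complex mat \<Rightarrow> complex mat fspace" where
  "orbit_variety m B = embedded_space (mat_coords m) (adjoint_orbit m B)"

definition regular_real_diagonal :: "nat \<Rightarrow> complex mat \<Rightarrow> bool" where
  "regular_real_diagonal m H \<longleftrightarrow> H \<in> carrier_mat m m \<and> diagonal_mat H \<and>
     (\<forall>i<m. H $$ (i, i) \<in> \<real>) \<and> inj_on (\<lambda>i. H $$ (i, i)) {..<m}"

definition height :: "complex mat \<Rightarrow> complex mat \<Rightarrow> complex" where
  "height H A = mat_trace (H * A)"

section \<open>The cotangent bundle of projective space\<close>

definition glue :: "'i set \<Rightarrow> ('i \<Rightarrow> 'a fspace) \<Rightarrow> ('i \<Rightarrow> 'a \<Rightarrow> 'b) \<Rightarrow> 'b fspace" where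
  "glue J Y \<psi> = \<lparr>zar = topology (\<lambda>U. U \<subseteq> (\<Union>j\<in>J. \<psi> j ` points (Y j)) \<and>
       (\<forall>j\<in>J. openin (zar (Y j)) {p \<in> points (Y j). \<psi> j p \<in> U})),
     reg = (\<lambda>U. {f. \<forall>j\<in>J. f \<circ> \<psi> j \<in> reg (Y j) {p \<in> points (Y j). \<psi> j p \<in> U}})\<rparr>"

lemma openin_glue:
  "openin (zar (glue J Y \<psi>)) U \<longleftrightarrow> U \<subseteq> (\<Union>j\<in>J. \<psi> j ` points (Y j)) \<and>
     (\<forall>j\<in>J. openin (zar (Y j)) {p \<in> points (Y j). \<psi> j p \<in> U})"
proof -
  have "istopology (\<lambda>U. U \<subseteq> (\<Union>j\<in>J. \<psi> j ` points (Y j)) \<and>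
          (\<forall>j\<in>J. openin (zar (Y j)) {p \<in> points (Y j). \<psi> j p \<in> U}))"
    unfolding istopology_def
  proof (intro conjI allI impI ballI)
    fix S T j
    assume *: "S \<subseteq> (\<Union>j\<in>J. \<psi> j ` points (Y j)) \<and>
        (\<forall>j\<in>J. openin (zar (Y j)) {p \<in> points (Y j). \<psi> j p \<in> S})"
      "T \<subseteq> (\<Union>j\<in>J. \<psi> j ` points (Y j)) \<and>
        (\<forall>j\<in>J. openin (zar (Y j)) {p \<in> points (Y j). \<psi> j p \<in> T})" and j: "j \<in> J"
    have "{p \<in> points (Y j). \<psi> j p \<in> S \<inter> T} =
        {p \<in> points (Y j). \<psi> j p \<in> S} \<inter> {p \<in> points (Y j). \<psi> j p \<in> T}" by auto
    then show "openin (zar (Y j)) {p \<in> points (Y j). \<psi> j p \<in> S \<inter> T}"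
      using * j by auto
  next
    fix \<K> j
    assume *: "\<forall>K\<in>\<K>. K \<subseteq> (\<Union>j\<in>J. \<psi> j ` points (Y j)) \<and>
        (\<forall>j\<in>J. openin (zar (Y j)) {p \<in> points (Y j). \<psi> j p \<in> K})" and j: "j \<in> J"
    have "{p \<in> points (Y j). \<psi> j p \<in> \<Union>\<K>} = (\<Union>K\<in>\<K>. {p \<in> points (Y j). \<psi> j p \<in> K})" by auto
    then show "openin (zar (Y j)) {p \<in> points (Y j). \<psi> j p \<in> \<Union>\<K>}"
      using * j by auto
  qed auto
  then show ?thesis by (simp add: glue_def)
qed

text \<open>
  \<open>\<P>\<^sup>n\<close> has the charts \<open>V\<^sub>j = {X\<^sub>j \<noteq> 0}\<close>, \<open>j = 0, \<dots>, n\<close>, with coordinates \<open>x\<^sub>i = X\<^sub>i / X\<^sub>j\<close> for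
  \<open>i \<in> {0..n} - {j}\<close>, so \<open>x(j := 1)\<close> is a vector of homogeneous coordinates of \<open>x\<close>. The chart of
  the cotangent bundle over \<open>V\<^sub>j\<close> has in addition the dual fibre coordinates \<open>y\<^sub>i\<close> of
  \<open>\<Sum>\<^sub>i y\<^sub>i dx\<^sub>i\<close>; two charts are glued by
  \<open>\<Sum>\<^sub>i y\<^sub>i dx\<^sub>i = \<Sum>\<^sub>l y'\<^sub>l dx'\<^sub>l\<close>, i.e. by the transposed Jacobian matrix of the transition map.
\<close>

definition chart_index :: "nat \<Rightarrow> nat \<Rightarrow> nat set" where
  "chart_index n j = {0..n} - {j}"

definition transition :: "nat \<Rightarrow> nat \<Rightarrow> nat \<Rightarrow> (nat \<Rightarrow> complex) \<Rightarrow> nat \<Rightarrow> complex" where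
  "transition n j k x = (\<lambda>l\<in>chart_index n k. (x(j := 1)) l / (x(j := 1)) k)"

definition transition_jacobian ::
    "nat \<Rightarrow> nat \<Rightarrow> nat \<Rightarrow> (nat \<Rightarrow> complex) \<Rightarrow> nat \<Rightarrow> nat \<Rightarrow> complex" where
  "transition_jacobian n j k x l i = deriv (\<lambda>t. transition n j k (x(i := t)) l) (x i)"

type_synonym chart_point = "(nat \<Rightarrow> complex) \<times> (nat \<Rightarrow> complex)"

definition cotangent_chart_space :: "nat \<Rightarrow> nat \<Rightarrow> chart_point fspace" where
  "cotangent_chart_space n j = embedded_space
     ({\<lambda>(x, y). x i | i. i \<in> chart_index n j} \<union> {\<lambda>(x, y). y i | i. i \<in> chart_index n j})
     (affine_points (chart_index n j) \<times> affine_points (chart_index n j))"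

definition cotangent_gluing :: "nat \<Rightarrow> ((nat \<times> chart_point) \<times> (nat \<times> chart_point)) set" where
  "cotangent_gluing n = {((j, (x, y)), (k, (x', y'))) | j x y k x' y'.
     j \<le> n \<and> k \<le> n \<and>
     x \<in> affine_points (chart_index n j) \<and> y \<in> affine_points (chart_index n j) \<and>
     x' \<in> affine_points (chart_index n k) \<and> y' \<in> affine_points (chart_index n k) \<and>
     (x(j := 1)) k \<noteq> 0 \<and> x' = transition n j k x \<and>
     (\<forall>i\<in>chart_index n j. y i = (\<Sum>l\<in>chart_index n k. y' l * transition_jacobian n j k x l i))}"

definition cotangent_chart :: "nat \<Rightarrow> nat \<Rightarrow> chart_point \<Rightarrow> (nat \<times> chart_point) set" where
  "cotangent_chart n j p = cotangent_gluing n `` {(j, p)}"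

definition cotangent_bundle :: "nat \<Rightarrow> (nat \<times> chart_point) set fspace" where
  "cotangent_bundle n = glue {0..n} (cotangent_chart_space n) (cotangent_chart n)"

definition toric_potential :: "nat \<Rightarrow> complex \<Rightarrow> (nat \<times> chart_point) set \<Rightarrow> complex" where
  "toric_potential n c = (THE h.
     h \<in> extensional (points (cotangent_bundle n)) \<and>
     h \<in> reg (cotangent_bundle n) (points (cotangent_bundle n)) \<and>
     (\<forall>(x, y)\<in>points (cotangent_chart_space n 0).
        h (cotangent_chart n 0 (x, y)) = c - (\<Sum>i=1..n. 2 * of_nat i * x i * y i)))"

end

theory Submission
  imports Defs
begin

text \<open>
  A point \<open>A\<close> of the minimal orbit is \<open>u w\<^sup>T - 1\<close> with \<open>w\<^sup>T u = n + 1\<close>, and a point of \<open>T\<^sup>*\<P>\<^sup>n\<close> is a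
  class of pairs \<open>(v, \<xi>)\<close> with \<open>\<xi>\<^sup>T v = 0\<close>. Where \<open>u\<^sub>0 w\<^sub>0 \<noteq> 0\<close>, the coordinates \<open>x\<^sub>i = u\<^sub>i / u\<^sub>0\<close>,
  \<open>y\<^sub>i = u\<^sub>0 w\<^sub>i\<close> identify an open subset of the orbit with the open subset \<open>v\<^sub>0 \<xi>\<^sub>0 + n + 1 \<noteq> 0\<close> of
  the chart \<open>V\<^sub>0\<close>. The height function of \<open>H = Diag(n, n - 2, \<dots>, -n)\<close> is there
  \<open>n (n + 1) - \<Sum> 2 i x\<^sub>i y\<^sub>i\<close>, because \<open>x\<^sub>i y\<^sub>i = u\<^sub>i w\<^sub>i\<close> and \<open>\<Sum> u\<^sub>i w\<^sub>i = n + 1\<close>. Both open sets are dense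
  because any point can be joined to a point of them by a rational curve. Separatedness of
  \<open>T\<^sup>*\<P>\<^sup>n\<close> follows from the fact that the global functions \<open>v\<^sub>a \<xi>\<^sub>b\<close> together with the
  homogeneous coordinates of the base point separate points.
\<close>

text \<open>The orbit fibres over P^n by sending \<open>u w^T - 1\<close> to the line of
  \<open>u\<close>. The fibre consists of the covectors pairing to n + 1 with \<open>u\<close>, an
  affine space over the cotangent fibre, where the pairing is 0. For n \<ge> 1 this twisted bundle
  has no global trivialisation: the orbit is affine, whereas the cotangent bundle contains the
  compact zero section. So the comparison can only be birational. Over \<open>V_0\<close> a
  trivialisation exists, namely \<open>w = \<xi> + (n + 1) e_0\<close> with \<open>v_0 = 1\<close>.
  Asking also for \<open>w_0 \<noteq> 0\<close> makes the cell a principal open set of the orbit, on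
  which all coordinates are read off with the single pivot \<open>u_0 w_0\<close>. On the other side
  the gluing is given by derivatives and the potential by a definite description. The derivatives
  are traded once and for all for the relation \<open>(v, \<xi>) ~ (c v, \<xi> / c)\<close>. The
  description is settled by the functions \<open>v_i \<xi>_i\<close>, which extend
  \<open>x_i y_i\<close> to the whole bundle, and by density of a subset of
  \<open>V_0\<close>.\<close>

subsection \<open>Zariski topologies\<close>

lemma polynomials_minus:
  assumes "p \<in> polynomials C" "q \<in> polynomials C"
  shows "(\<lambda>z. p z - q z) \<in> polynomials C"
  using polynomials.add[OF assms(1) polynomials.mult[OF polynomials.const[of "-1"] assms(2)]]
  by simp

lemma polynomials_sum:
  assumes "\<And>i. i \<in> I \<Longrightarrow> p i \<in> polynomials C"
  shows "(\<lambda>z. \<Sum>i\<in>I. p i z) \<in> polynomials C"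
  using assms by (induction I rule: infinite_finite_induct) (auto intro: polynomials.intros)

text \<open>A product of polynomials is a polynomial, so the generating principal sets are closed
  under finite intersection and already form a base. Openness can then be tested with one polynomial
  per point.\<close>

lemma openin_zariski_topology:
  "openin (zariski_topology C X) U \<longleftrightarrow>
     U \<subseteq> X \<and> (\<forall>a\<in>U. \<exists>p\<in>polynomials C. p a \<noteq> 0 \<and> {z \<in> X. p z \<noteq> 0} \<subseteq> U)"
    (is "_ \<longleftrightarrow> ?R U")
proof
  assume "openin (zariski_topology C X) U"
  then have "generate_topology_on {{z \<in> X. p z \<noteq> 0} | p. p \<in> polynomials C} U"
    unfolding zariski_topology_def by (rule openin_topology_generated_by)
  then show "?R U"
  proof induction
    case (Int a b)
    show ?case
    proof (intro conjI ballI)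
      fix x assume "x \<in> a \<inter> b"
      then have x: "x \<in> a" "x \<in> b" by auto
      obtain p where "p \<in> polynomials C" "p x \<noteq> 0" "{z \<in> X. p z \<noteq> 0} \<subseteq> a"
        using bspec[OF conjunct2[OF Int.IH(1)] x(1)] by auto
      moreover obtain q where "q \<in> polynomials C" "q x \<noteq> 0" "{z \<in> X. q z \<noteq> 0} \<subseteq> b"
        using bspec[OF conjunct2[OF Int.IH(2)] x(2)] by auto
      ultimately have pq: "p \<in> polynomials C" "q \<in> polynomials C" "p x \<noteq> 0" "q x \<noteq> 0"
        "{z \<in> X. p z \<noteq> 0} \<subseteq> a" "{z \<in> X. q z \<noteq> 0} \<subseteq> b" by auto
      then have "p x * q x \<noteq> 0" "{z \<in> X. p z * q z \<noteq> 0} \<subseteq> a \<inter> b" by auto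
      then show "\<exists>p\<in>polynomials C. p x \<noteq> 0 \<and> {z \<in> X. p z \<noteq> 0} \<subseteq> a \<inter> b"
        using polynomials.mult[OF pq(1,2)] by (intro bexI[of _ "\<lambda>z. p z * q z"]) auto
    qed (use Int in auto)
  next
    case (UN K)
    show ?case
    proof (intro conjI ballI)
      fix x assume "x \<in> \<Union>K"
      then obtain k where k: "k \<in> K" "x \<in> k" by auto
      then obtain p where "p \<in> polynomials C" "p x \<noteq> 0" "{z \<in> X. p z \<noteq> 0} \<subseteq> k"
        using bspec[OF conjunct2[OF UN.IH[OF k(1)]] k(2)] by auto
      with k show "\<exists>p\<in>polynomials C. p x \<noteq> 0 \<and> {z \<in> X. p z \<noteq> 0} \<subseteq> \<Union>K"
        by (intro bexI[of _ p]) auto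
    qed (use UN in auto)
  next
    case (Basis s)
    then show ?case by auto
  qed auto
next
  assume R: "?R U"
  have "\<exists>T. openin (zariski_topology C X) T \<and> a \<in> T \<and> T \<subseteq> U" if "a \<in> U" for a
  proof -
    obtain p where p: "p \<in> polynomials C" "p a \<noteq> 0" "{z \<in> X. p z \<noteq> 0} \<subseteq> U"
      using bspec[OF conjunct2[OF R] \<open>a \<in> U\<close>] by auto
    have "openin (zariski_topology C X) {z \<in> X. p z \<noteq> 0}"
      unfolding zariski_topology_def using p(1) by (auto intro: topology_generated_by_Basis)
    then show ?thesis using p R that by auto
  qed
  then show "openin (zariski_topology C X) U" by (subst openin_subopen) blast
qed

lemma openin_zariski_topologyE:
  assumes "openin (zariski_topology C X) U" "a \<in> U"
  obtains p where "p \<in> polynomials C" "p a \<noteq> 0" "{z \<in> X. p z \<noteq> 0} \<subseteq> U"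
  using bspec[OF conjunct2[OF iffD1[OF openin_zariski_topology assms(1)]] assms(2)] by auto

lemma openin_principal:
  assumes "p \<in> polynomials C"
  shows "openin (zariski_topology C X) {z \<in> X. p z \<noteq> 0}"
  using assms by (subst openin_zariski_topology) auto

lemma topspace_zariski_topology [simp]: "topspace (zariski_topology C X) = X"
proof -
  have "openin (zariski_topology C X) {z \<in> X. 1 \<noteq> (0::complex)}"
    by (rule openin_principal) (rule polynomials.const)
  then have "X \<subseteq> topspace (zariski_topology C X)"
    using openin_subset by fastforce
  moreover have "topspace (zariski_topology C X) \<subseteq> X"
    using openin_zariski_topology[of C X "topspace (zariski_topology C X)"] by simp
  ultimately show ?thesis by blast
qed

lemma zar_embedded_space [simp]: "zar (embedded_space C X) = zariski_topology C X"
  by (simp add: embedded_space_def)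

lemma zar_open_subspace [simp]: "zar (open_subspace X U) = subtopology (zar X) U"
  by (simp add: open_subspace_def)

lemma reg_open_subspace [simp]: "reg (open_subspace X U) = reg X"
  by (simp add: open_subspace_def)

lemma reg_embedded_space_iff:
  "f \<in> reg (embedded_space C X) U \<longleftrightarrow> (\<forall>a\<in>U. \<exists>W. openin (zariski_topology C X) W \<and> a \<in> W \<and>
     W \<subseteq> U \<and> (\<exists>p\<in>polynomials C. \<exists>q\<in>polynomials C. \<forall>z\<in>W. q z \<noteq> 0 \<and> f z = p z / q z))"
  by (simp add: embedded_space_def)

lemma reg_embedded_space_cases:
  assumes "f \<in> reg (embedded_space C X) U" "a \<in> U"
  obtains W p q where "openin (zariski_topology C X) W" "a \<in> W" "W \<subseteq> U"
    "p \<in> polynomials C" "q \<in> polynomials C" "\<And>z. z \<in> W \<Longrightarrow> q z \<noteq> 0"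
    "\<And>z. z \<in> W \<Longrightarrow> f z = p z / q z"
  using assms unfolding reg_embedded_space_iff by metis

lemma polynomials_regular:
  assumes "p \<in> polynomials C" "openin (zariski_topology C X) U"
  shows "p \<in> reg (embedded_space C X) U"
  unfolding reg_embedded_space_iff
  using assms polynomials.const[of 1 C]
  by (intro ballI exI[of _ U] conjI bexI[of _ p] bexI[of _ "\<lambda>_. 1"]) auto

subsection \<open>Spaces with a sheaf of rings of functions\<close>

text \<open>The common ground of embedded and glued spaces. With these axioms regularity is proved
  by calculating with functions instead of choosing local quotients. \<open>nonzero_open\<close> is
  the continuity of regular functions in the only form used: their zero sets are closed.\<close>

locale regular_space =
  fixes X :: "'a fspace"
  assumes sheaf: "function_sheaf X"
    and const: "openin (zar X) U \<Longrightarrow> (\<lambda>_. a) \<in> reg X U"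
    and add: "openin (zar X) U \<Longrightarrow> f \<in> reg X U \<Longrightarrow> g \<in> reg X U \<Longrightarrow> (\<lambda>z. f z + g z) \<in> reg X U"
    and mult: "openin (zar X) U \<Longrightarrow> f \<in> reg X U \<Longrightarrow> g \<in> reg X U \<Longrightarrow> (\<lambda>z. f z * g z) \<in> reg X U"
    and inverse: "openin (zar X) U \<Longrightarrow> f \<in> reg X U \<Longrightarrow> (\<And>z. z \<in> U \<Longrightarrow> f z \<noteq> 0) \<Longrightarrow>
      (\<lambda>z. inverse (f z)) \<in> reg X U"
    and nonzero_open: "openin (zar X) U \<Longrightarrow> f \<in> reg X U \<Longrightarrow> openin (zar X) {z \<in> U. f z \<noteq> 0}"
begin

lemma restrict:
  assumes "f \<in> reg X U" "openin (zar X) U" "openin (zar X) V" "V \<subseteq> U"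
  shows "f \<in> reg X V"
  by (rule conjunct1[OF sheaf[unfolded function_sheaf_def], rule_format, of U]) (intro conjI assms)

lemma local:
  assumes "openin (zar X) U"
    "\<And>p. p \<in> U \<Longrightarrow> \<exists>V g. openin (zar X) V \<and> p \<in> V \<and> V \<subseteq> U \<and> g \<in> reg X V \<and> (\<forall>q\<in>V. f q = g q)"
  shows "f \<in> reg X U"
  by (rule conjunct2[OF sheaf[unfolded function_sheaf_def], rule_format]) (intro conjI ballI assms; assumption)

lemma cong:
  assumes "g \<in> reg X U" "openin (zar X) U" "\<And>z. z \<in> U \<Longrightarrow> f z = g z"
  shows "f \<in> reg X U"
proof (rule local)
  fix p assume "p \<in> U"
  then show "\<exists>V g. openin (zar X) V \<and> p \<in> V \<and> V \<subseteq> U \<and> g \<in> reg X V \<and> (\<forall>q\<in>V. f q = g q)"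
    using assms by (intro exI[of _ U] exI[of _ g]) auto
qed (rule assms(2))

lemma minus:
  assumes "openin (zar X) U" "f \<in> reg X U" "g \<in> reg X U"
  shows "(\<lambda>z. f z - g z) \<in> reg X U"
  using add[OF assms(1,2) mult[OF assms(1) const[OF assms(1), of "-1"] assms(3)]] by simp

lemma divide:
  assumes "openin (zar X) U" "f \<in> reg X U" "g \<in> reg X U" "\<And>z. z \<in> U \<Longrightarrow> g z \<noteq> 0"
  shows "(\<lambda>z. f z / g z) \<in> reg X U"
  using mult[OF assms(1,2) inverse[OF assms(1,3,4)]] by (simp add: divide_inverse)

lemma sum:
  assumes "openin (zar X) U" "\<And>i. i \<in> I \<Longrightarrow> f i \<in> reg X U"
  shows "(\<lambda>z. \<Sum>i\<in>I. f i z) \<in> reg X U"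
  using assms(2)
  by (induction I rule: infinite_finite_induct) (auto intro: const[OF assms(1)] add[OF assms(1)])

lemma polynomials_comp:
  assumes "openin (zar X) U" "\<And>c. c \<in> C \<Longrightarrow> (\<lambda>z. c (\<phi> z)) \<in> reg X U" "p \<in> polynomials C"
  shows "(\<lambda>z. p (\<phi> z)) \<in> reg X U"
  using assms(3) by induction (auto intro: assms(2) const[OF assms(1)] add[OF assms(1)] mult[OF assms(1)])

text \<open>Only the coordinates have to be checked. They generate the polynomials, a principal open
  set pulls back to the nonvanishing set of a regular function, and a local quotient pulls back to a
  quotient of regular functions.\<close>

lemma morphism_into_embedded:
  assumes into: "\<And>z. z \<in> points X \<Longrightarrow> \<phi> z \<in> Y"
    and coords: "\<And>c. c \<in> C \<Longrightarrow> (\<lambda>z. c (\<phi> z)) \<in> reg X (points X)"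
  shows "morphism X (embedded_space C Y) \<phi>"
proof -
  have poly: "(\<lambda>z. p (\<phi> z)) \<in> reg X (points X)" if "p \<in> polynomials C" for p
    using polynomials_comp[OF openin_topspace coords that] .
  have cont: "openin (zar X) {z \<in> points X. \<phi> z \<in> V}" if V: "openin (zariski_topology C Y) V" for V
  proof (subst openin_subopen, intro ballI)
    fix a assume a: "a \<in> {z \<in> points X. \<phi> z \<in> V}"
    then obtain p where p: "p \<in> polynomials C" "p (\<phi> a) \<noteq> 0" "{z \<in> Y. p z \<noteq> 0} \<subseteq> V"
      using openin_zariski_topologyE[OF V, of "\<phi> a"] by auto
    have "openin (zar X) {z \<in> points X. p (\<phi> z) \<noteq> 0}"
      using nonzero_open[OF openin_topspace poly[OF p(1)]] by simp
    then show "\<exists>T. openin (zar X) T \<and> a \<in> T \<and> T \<subseteq> {z \<in> points X. \<phi> z \<in> V}"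
      using a p into by (intro exI[of _ "{z \<in> points X. p (\<phi> z) \<noteq> 0}"]) auto
  qed
  show ?thesis
    unfolding morphism_def
  proof (intro conjI allI impI ballI)
    show "continuous_map (zar X) (zar (embedded_space C Y)) \<phi>"
      using into cont by (auto simp: continuous_map_def Pi_iff)
  next
    fix V f assume V: "openin (zar (embedded_space C Y)) V" and f: "f \<in> reg (embedded_space C Y) V"
    show "f \<circ> \<phi> \<in> reg X {z \<in> points X. \<phi> z \<in> V}"
    proof (rule local)
      fix a assume "a \<in> {z \<in> points X. \<phi> z \<in> V}"
      then have a: "a \<in> points X" "\<phi> a \<in> V" by auto
      obtain W p q where W: "openin (zariski_topology C Y) W" "\<phi> a \<in> W" "W \<subseteq> V"
        and p: "p \<in> polynomials C" and q: "q \<in> polynomials C"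
        and nz: "\<And>z. z \<in> W \<Longrightarrow> q z \<noteq> 0" and eq: "\<And>z. z \<in> W \<Longrightarrow> f z = p z / q z"
        using reg_embedded_space_cases[OF f a(2)] by metis
      let ?W = "{z \<in> points X. \<phi> z \<in> W}"
      have W': "openin (zar X) ?W" using cont W(1) by blast
      have "(\<lambda>z. p (\<phi> z) / q (\<phi> z)) \<in> reg X ?W"
        using W' nz by (intro divide restrict[OF poly[OF p]] restrict[OF poly[OF q]]) auto
      then show "\<exists>V' g. openin (zar X) V' \<and> a \<in> V' \<and> V' \<subseteq> {z \<in> points X. \<phi> z \<in> V} \<and>
          g \<in> reg X V' \<and> (\<forall>q\<in>V'. (f \<circ> \<phi>) q = g q)"
        using W W' a eq by (intro exI[of _ ?W] exI[of _ "\<lambda>z. p (\<phi> z) / q (\<phi> z)"]) auto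
    qed (use cont V in auto)
  qed
qed

lemma regular_space_open_subspace:
  assumes U: "openin (zar X) U"
  shows "regular_space (open_subspace X U)"
proof
  show "function_sheaf (open_subspace X U)"
    unfolding function_sheaf_def
  proof (intro conjI allI impI)
    fix S T f
    assume "openin (zar (open_subspace X U)) S \<and> openin (zar (open_subspace X U)) T \<and>
      T \<subseteq> S \<and> f \<in> reg (open_subspace X U) S"
    then show "f \<in> reg (open_subspace X U) T"
      using U by (auto simp: openin_open_subtopology intro: restrict)
  next
    fix S f
    assume "openin (zar (open_subspace X U)) S \<and> (\<forall>p\<in>S. \<exists>V g. openin (zar (open_subspace X U)) V \<and>
      p \<in> V \<and> V \<subseteq> S \<and> g \<in> reg (open_subspace X U) V \<and> (\<forall>q\<in>V. f q = g q))"
    then have S: "openin (zar X) S" and loc: "\<forall>p\<in>S. \<exists>V g. openin (zar X) V \<and> p \<in> V \<and> V \<subseteq> S \<and>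
        g \<in> reg X V \<and> (\<forall>q\<in>V. f q = g q)"
      unfolding zar_open_subspace reg_open_subspace openin_open_subtopology[OF U] by meson+
    show "f \<in> reg (open_subspace X U) S"
      unfolding reg_open_subspace using loc by (intro local S) meson
  qed
next
  fix V f assume "openin (zar (open_subspace X U)) V" "f \<in> reg (open_subspace X U) V"
  then have V: "openin (zar X) V" "V \<subseteq> U" "f \<in> reg X V"
    unfolding zar_open_subspace reg_open_subspace openin_open_subtopology[OF U] by auto
  have "openin (zar X) {z \<in> V. f z \<noteq> 0}" using V by (intro nonzero_open)
  then show "openin (zar (open_subspace X U)) {z \<in> V. f z \<noteq> 0}"
    unfolding zar_open_subspace openin_open_subtopology[OF U] using V(2) by blast
next
  fix V f assume "openin (zar (open_subspace X U)) V" "f \<in> reg (open_subspace X U) V"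
    "\<And>z. z \<in> V \<Longrightarrow> f z \<noteq> 0"
  then show "(\<lambda>z. inverse (f z)) \<in> reg (open_subspace X U) V"
    unfolding zar_open_subspace reg_open_subspace openin_open_subtopology[OF U]
    by (intro inverse) auto
next
  fix V f g assume "openin (zar (open_subspace X U)) V"
    "f \<in> reg (open_subspace X U) V" "g \<in> reg (open_subspace X U) V"
  then have "openin (zar X) V" "f \<in> reg X V" "g \<in> reg X V"
    unfolding zar_open_subspace reg_open_subspace openin_open_subtopology[OF U] by auto
  then show "(\<lambda>z. f z + g z) \<in> reg (open_subspace X U) V"
    and "(\<lambda>z. f z * g z) \<in> reg (open_subspace X U) V"
    unfolding reg_open_subspace by (rule add, rule mult)
next
  fix V and a :: complex assume "openin (zar (open_subspace X U)) V"
  then show "(\<lambda>_. a) \<in> reg (open_subspace X U) V"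
    unfolding zar_open_subspace reg_open_subspace openin_open_subtopology[OF U]
    by (intro const) (rule conjunct1)
qed

end

lemma regular_space_embedded: "regular_space (embedded_space C X)"
proof
  show "function_sheaf (embedded_space C X)"
    unfolding function_sheaf_def
  proof (intro conjI allI impI)
    fix U V f
    assume "openin (zar (embedded_space C X)) U \<and> openin (zar (embedded_space C X)) V \<and>
      V \<subseteq> U \<and> f \<in> reg (embedded_space C X) U"
    then have V: "openin (zariski_topology C X) V" "V \<subseteq> U" and f: "f \<in> reg (embedded_space C X) U"
      by auto
    show "f \<in> reg (embedded_space C X) V"
      unfolding reg_embedded_space_iff
    proof
      fix a assume a: "a \<in> V"
      then have "a \<in> U" using V by auto
      from reg_embedded_space_cases[OF f this] obtain W p q where
        "openin (zariski_topology C X) W" "a \<in> W" "W \<subseteq> U" "p \<in> polynomials C" "q \<in> polynomials C"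
        "\<And>z. z \<in> W \<Longrightarrow> q z \<noteq> 0" "\<And>z. z \<in> W \<Longrightarrow> f z = p z / q z" by metis
      then show "\<exists>W. openin (zariski_topology C X) W \<and> a \<in> W \<and> W \<subseteq> V \<and>
          (\<exists>p\<in>polynomials C. \<exists>q\<in>polynomials C. \<forall>z\<in>W. q z \<noteq> 0 \<and> f z = p z / q z)"
        using V a by (intro exI[of _ "W \<inter> V"] conjI bexI[of _ p] bexI[of _ q]) auto
    qed
  next
    fix U f
    assume *: "openin (zar (embedded_space C X)) U \<and> (\<forall>p\<in>U. \<exists>V g. openin (zar (embedded_space C X)) V \<and>
      p \<in> V \<and> V \<subseteq> U \<and> g \<in> reg (embedded_space C X) V \<and> (\<forall>q\<in>V. f q = g q))"
    show "f \<in> reg (embedded_space C X) U"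
      unfolding reg_embedded_space_iff
    proof
      fix a assume a: "a \<in> U"
      then obtain V g where V: "a \<in> V" "V \<subseteq> U" "g \<in> reg (embedded_space C X) V" "\<forall>q\<in>V. f q = g q"
        using * by blast
      from reg_embedded_space_cases[OF V(3,1)] obtain W p q where
        "openin (zariski_topology C X) W" "a \<in> W" "W \<subseteq> V" "p \<in> polynomials C" "q \<in> polynomials C"
        "\<And>z. z \<in> W \<Longrightarrow> q z \<noteq> 0" "\<And>z. z \<in> W \<Longrightarrow> g z = p z / q z" by metis
      then show "\<exists>W. openin (zariski_topology C X) W \<and> a \<in> W \<and> W \<subseteq> U \<and>
          (\<exists>p\<in>polynomials C. \<exists>q\<in>polynomials C. \<forall>z\<in>W. q z \<noteq> 0 \<and> f z = p z / q z)"
        using V by (intro exI[of _ W] conjI bexI[of _ p] bexI[of _ q]) auto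
    qed
  qed
next
  fix U and a :: complex assume "openin (zar (embedded_space C X)) U"
  then show "(\<lambda>_. a) \<in> reg (embedded_space C X) U"
    by (intro polynomials_regular polynomials.const) auto
next
  fix U f g assume f: "f \<in> reg (embedded_space C X) U" and g: "g \<in> reg (embedded_space C X) U"
  have "\<exists>W. openin (zariski_topology C X) W \<and> a \<in> W \<and> W \<subseteq> U \<and>
          (\<exists>p\<in>polynomials C. \<exists>q\<in>polynomials C. \<forall>z\<in>W. q z \<noteq> 0 \<and> f z + g z = p z / q z) \<and>
          (\<exists>p\<in>polynomials C. \<exists>q\<in>polynomials C. \<forall>z\<in>W. q z \<noteq> 0 \<and> f z * g z = p z / q z)"
    if a: "a \<in> U" for a
  proof -
    obtain W p q where 1: "openin (zariski_topology C X) W" "a \<in> W" "W \<subseteq> U"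
      "p \<in> polynomials C" "q \<in> polynomials C"
      "\<And>z. z \<in> W \<Longrightarrow> q z \<noteq> 0" "\<And>z. z \<in> W \<Longrightarrow> f z = p z / q z"
      using reg_embedded_space_cases[OF f a] by metis
    obtain W' p' q' where 2: "openin (zariski_topology C X) W'" "a \<in> W'" "W' \<subseteq> U"
      "p' \<in> polynomials C" "q' \<in> polynomials C"
      "\<And>z. z \<in> W' \<Longrightarrow> q' z \<noteq> 0" "\<And>z. z \<in> W' \<Longrightarrow> g z = p' z / q' z"
      using reg_embedded_space_cases[OF g a] by metis
    have "(\<lambda>z. p z * q' z + p' z * q z) \<in> polynomials C" "(\<lambda>z. p z * p' z) \<in> polynomials C"
      "(\<lambda>z. q z * q' z) \<in> polynomials C"
      using 1 2 by (auto intro!: polynomials.add polynomials.mult)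
    moreover have "q z * q' z \<noteq> 0" "f z + g z = (p z * q' z + p' z * q z) / (q z * q' z)"
      "f z * g z = (p z * p' z) / (q z * q' z)" if "z \<in> W \<inter> W'" for z
      using that 1(6,7)[of z] 2(6,7)[of z] by (auto simp: add_frac_eq)
    ultimately have "(\<exists>p\<in>polynomials C. \<exists>q\<in>polynomials C. \<forall>z\<in>W \<inter> W'. q z \<noteq> 0 \<and> f z + g z = p z / q z)"
      "(\<exists>p\<in>polynomials C. \<exists>q\<in>polynomials C. \<forall>z\<in>W \<inter> W'. q z \<noteq> 0 \<and> f z * g z = p z / q z)"
      by meson+
    moreover have "openin (zariski_topology C X) (W \<inter> W')" "a \<in> W \<inter> W'" "W \<inter> W' \<subseteq> U"
      using 1 2 by auto
    ultimately show ?thesis by blast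
  qed
  then show "(\<lambda>z. f z + g z) \<in> reg (embedded_space C X) U"
    and "(\<lambda>z. f z * g z) \<in> reg (embedded_space C X) U"
    unfolding reg_embedded_space_iff by meson+
next
  fix U f assume U: "openin (zar (embedded_space C X)) U" and f: "f \<in> reg (embedded_space C X) U"
  \<comment> \<open>Shrinking the neighbourhood to where the numerator is nonzero serves both
    remaining axioms: \<open>f\<close> does not vanish on it, and its reciprocal is
    \<open>q / p\<close> there.\<close>
  have loc: "\<exists>W p q. openin (zariski_topology C X) W \<and> a \<in> W \<and> W \<subseteq> U \<and>
      p \<in> polynomials C \<and> q \<in> polynomials C \<and> (\<forall>z\<in>W. p z \<noteq> 0 \<and> q z \<noteq> 0 \<and> f z = p z / q z)"
    if a: "a \<in> U" "f a \<noteq> 0" for a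
  proof -
    obtain W p q where 1: "openin (zariski_topology C X) W" "a \<in> W" "W \<subseteq> U"
      "p \<in> polynomials C" "q \<in> polynomials C"
      "\<And>z. z \<in> W \<Longrightarrow> q z \<noteq> 0" "\<And>z. z \<in> W \<Longrightarrow> f z = p z / q z"
      using reg_embedded_space_cases[OF f a(1)] by metis
    have "W \<subseteq> X" using 1(1) openin_subset by fastforce
    then have "a \<in> W \<inter> {z \<in> X. p z \<noteq> 0}" using 1 a by auto
    moreover have "openin (zariski_topology C X) (W \<inter> {z \<in> X. p z \<noteq> 0})"
      using 1 openin_principal by blast
    ultimately show ?thesis
      using 1 by (intro exI[of _ "W \<inter> {z \<in> X. p z \<noteq> 0}"] exI[of _ p] exI[of _ q]) auto
  qed
  show "openin (zar (embedded_space C X)) {z \<in> U. f z \<noteq> 0}"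
  proof (subst openin_subopen, intro ballI)
    fix a assume "a \<in> {z \<in> U. f z \<noteq> 0}"
    then have a: "a \<in> U" "f a \<noteq> 0" by auto
    obtain W p q where W: "openin (zariski_topology C X) W \<and> a \<in> W \<and> W \<subseteq> U \<and>
      p \<in> polynomials C \<and> q \<in> polynomials C \<and> (\<forall>z\<in>W. p z \<noteq> 0 \<and> q z \<noteq> 0 \<and> f z = p z / q z)"
      using loc[OF a] by metis
    show "\<exists>T. openin (zar (embedded_space C X)) T \<and> a \<in> T \<and> T \<subseteq> {z \<in> U. f z \<noteq> 0}"
      using W a by (intro exI[of _ W]) auto
  qed
  assume nz: "\<And>z. z \<in> U \<Longrightarrow> f z \<noteq> 0"
  show "(\<lambda>z. inverse (f z)) \<in> reg (embedded_space C X) U"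
    unfolding reg_embedded_space_iff
  proof
    fix a assume a: "a \<in> U"
    obtain W p q where W: "openin (zariski_topology C X) W \<and> a \<in> W \<and> W \<subseteq> U \<and>
      p \<in> polynomials C \<and> q \<in> polynomials C \<and> (\<forall>z\<in>W. p z \<noteq> 0 \<and> q z \<noteq> 0 \<and> f z = p z / q z)"
      using loc[OF a nz[OF a]] by metis
    show "\<exists>W. openin (zariski_topology C X) W \<and> a \<in> W \<and> W \<subseteq> U \<and>
       (\<exists>p\<in>polynomials C. \<exists>q\<in>polynomials C. \<forall>z\<in>W. q z \<noteq> 0 \<and> inverse (f z) = p z / q z)"
      using W by (intro exI[of _ W] conjI bexI[of _ q] bexI[of _ p]) auto
  qed
qed

subsection \<open>Morphisms\<close>

lemma morphism_into:
  "morphism X Y \<phi> \<Longrightarrow> p \<in> points X \<Longrightarrow> \<phi> p \<in> points Y"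
  unfolding morphism_def continuous_map_def by auto

lemma morphism_openin:
  "morphism X Y \<phi> \<Longrightarrow> openin (zar Y) V \<Longrightarrow> openin (zar X) {p \<in> points X. \<phi> p \<in> V}"
  unfolding morphism_def continuous_map_def by auto

lemma morphism_regular:
  "morphism X Y \<phi> \<Longrightarrow> openin (zar Y) V \<Longrightarrow> f \<in> reg Y V \<Longrightarrow>
    (\<lambda>p. f (\<phi> p)) \<in> reg X {p \<in> points X. \<phi> p \<in> V}"
  unfolding morphism_def comp_def by blast

lemma morphism_compose:
  assumes \<phi>: "morphism X Y \<phi>" and \<psi>: "morphism Y Z \<psi>"
  shows "morphism X Z (\<psi> \<circ> \<phi>)"
  unfolding morphism_def
proof (intro conjI allI impI ballI)
  show "continuous_map (zar X) (zar Z) (\<psi> \<circ> \<phi>)"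
    using assms unfolding morphism_def by (metis continuous_map_compose)
next
  fix V f assume V: "openin (zar Z) V" and f: "f \<in> reg Z V"
  have "(\<lambda>p. f (\<psi> (\<phi> p))) \<in> reg X {p \<in> points X. \<phi> p \<in> {q \<in> points Y. \<psi> q \<in> V}}"
    by (rule morphism_regular[OF \<phi> morphism_openin[OF \<psi> V] morphism_regular[OF \<psi> V f]])
  moreover have "{p \<in> points X. \<phi> p \<in> {q \<in> points Y. \<psi> q \<in> V}} =
      {p \<in> points X. (\<psi> \<circ> \<phi>) p \<in> V}"
    using morphism_into[OF \<phi>] by auto
  ultimately show "f \<circ> (\<psi> \<circ> \<phi>) \<in> reg X {p \<in> points X. (\<psi> \<circ> \<phi>) p \<in> V}"
    by (simp add: comp_def)
qed

lemma morphism_into_open_subspace: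
  assumes \<phi>: "morphism X Y \<phi>" and U: "openin (zar Y) U" and into: "\<And>p. p \<in> points X \<Longrightarrow> \<phi> p \<in> U"
  shows "morphism X (open_subspace Y U) \<phi>"
  using assms unfolding morphism_def
  by (auto simp: openin_open_subtopology continuous_map_in_subtopology)

lemma isomorphism_compose:
  assumes "isomorphism X Y \<phi>" "isomorphism Y Z \<psi>"
  shows "isomorphism X Z (\<psi> \<circ> \<phi>)"
proof -
  obtain \<phi>' \<psi>' where 1: "morphism Y X \<phi>'" "\<forall>p\<in>points X. \<phi>' (\<phi> p) = p" "\<forall>q\<in>points Y. \<phi> (\<phi>' q) = q"
    and 2: "morphism Z Y \<psi>'" "\<forall>p\<in>points Y. \<psi>' (\<psi> p) = p" "\<forall>q\<in>points Z. \<psi> (\<psi>' q) = q"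
    using assms unfolding isomorphism_def by metis
  have m: "morphism X Y \<phi>" "morphism Y Z \<psi>" using assms unfolding isomorphism_def by auto
  show ?thesis
    unfolding isomorphism_def
    using 1 2 m morphism_into[OF m(1)] morphism_into[OF 2(1)]
    by (intro conjI exI[of _ "\<phi>' \<circ> \<psi>'"] morphism_compose[OF m] morphism_compose[OF 2(1) 1(1)]) auto
qed

subsection \<open>Affineness, separatedness, density\<close>

text \<open>Affineness is defined through coordinates numbered below \<open>N\<close>, whereas the
  spaces at hand use matrix entries or pairs of vectors. \<open>d\<close> lists the given
  coordinates and \<open>G\<close> reassembles a point from the list. Both are polynomial, hence
  mutually inverse morphisms.\<close>

lemma affine_varietyI:
  assumes Z: "algebraic_subset N Z"
    and d: "\<And>i. i < N \<Longrightarrow> d i \<in> polynomials C"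
    and c: "\<And>c. c \<in> C \<Longrightarrow> (\<lambda>v. c (G v)) \<in> polynomials (affine_coords {..<N})"
    and F: "\<And>x. x \<in> X \<Longrightarrow> (\<lambda>i\<in>{..<N}. d i x) \<in> Z"
    and G: "\<And>v. v \<in> Z \<Longrightarrow> G v \<in> X"
    and GF: "\<And>x. x \<in> X \<Longrightarrow> G (\<lambda>i\<in>{..<N}. d i x) = x"
    and FG: "\<And>v. v \<in> Z \<Longrightarrow> (\<lambda>i\<in>{..<N}. d i (G v)) = v"
  shows "affine_variety (embedded_space C X)"
proof -
  interpret X: regular_space "embedded_space C X" by (rule regular_space_embedded)
  interpret Z: regular_space "embedded_space (affine_coords {..<N}) Z" by (rule regular_space_embedded)
  have "(\<lambda>x. e (\<lambda>i\<in>{..<N}. d i x)) \<in> reg (embedded_space C X) X" if e: "e \<in> affine_coords {..<N}" for e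
  proof -
    obtain i where "i < N" "e = (\<lambda>v. v i)" using e unfolding affine_coords_def by auto
    then show ?thesis
      using polynomials_regular[OF d openin_topspace[of "zariski_topology C X"]] by auto
  qed
  then have "morphism (embedded_space C X) (embedded_space (affine_coords {..<N}) Z) (\<lambda>x. \<lambda>i\<in>{..<N}. d i x)"
    by (intro X.morphism_into_embedded) (auto simp: F)
  moreover have "morphism (embedded_space (affine_coords {..<N}) Z) (embedded_space C X) G"
    using polynomials_regular[OF c openin_topspace[of "zariski_topology (affine_coords {..<N}) Z"]]
    by (intro Z.morphism_into_embedded) (auto simp: G)
  ultimately have "isomorphism (embedded_space C X) (embedded_space (affine_coords {..<N}) Z)
      (\<lambda>x. \<lambda>i\<in>{..<N}. d i x)"
    unfolding isomorphism_def using GF FG by auto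
  then show ?thesis unfolding affine_variety_def using Z by blast
qed

text \<open>The part of \<open>W\<close> where \<open>h\<close> is nonzero is an open neighbourhood
  of \<open>a\<close> on which \<open>f\<close> and \<open>g\<close> differ. Letting
  \<open>h\<close> depend on \<open>a\<close> and live only near it matters for the cotangent
  bundle: the functions \<open>v_a \<xi>_b\<close> all vanish on the zero section, so functions
  defined over charts are needed as well.\<close>

lemma separatedI:
  assumes "\<And>N Z f g a. morphism (embedded_space (affine_coords {..<N}) Z) X f \<Longrightarrow>
      morphism (embedded_space (affine_coords {..<N}) Z) X g \<Longrightarrow> a \<in> Z \<Longrightarrow> f a \<noteq> g a \<Longrightarrow>
      \<exists>W h. openin (zariski_topology (affine_coords {..<N}) Z) W \<and> a \<in> W \<and>
        h \<in> reg (embedded_space (affine_coords {..<N}) Z) W \<and> h a \<noteq> 0 \<and>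
        (\<forall>z\<in>W. f z = g z \<longrightarrow> h z = 0)"
  shows "separated X"
  unfolding separated_def
proof (intro allI impI)
  fix N Z f g
  assume fg: "morphism (embedded_space (affine_coords {..<N}) Z) X f"
      "morphism (embedded_space (affine_coords {..<N}) Z) X g"
  interpret Z: regular_space "embedded_space (affine_coords {..<N}) Z" by (rule regular_space_embedded)
  have "openin (zariski_topology (affine_coords {..<N}) Z) {z \<in> Z. f z \<noteq> g z}"
  proof (subst openin_subopen, intro ballI)
    fix a assume "a \<in> {z \<in> Z. f z \<noteq> g z}"
    then obtain W h where W: "openin (zariski_topology (affine_coords {..<N}) Z) W" "a \<in> W"
        "h \<in> reg (embedded_space (affine_coords {..<N}) Z) W" "h a \<noteq> 0"
        "\<forall>z\<in>W. f z = g z \<longrightarrow> h z = 0"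
      using assms[OF fg] by blast
    moreover have "W \<subseteq> Z" using W(1) openin_subset by fastforce
    ultimately show "\<exists>T. openin (zariski_topology (affine_coords {..<N}) Z) T \<and> a \<in> T \<and>
        T \<subseteq> {z \<in> Z. f z \<noteq> g z}"
      using Z.nonzero_open[of W h] by (intro exI[of _ "{z \<in> W. h z \<noteq> 0}"]) auto
  qed
  moreover have "Z - {z \<in> Z. f z = g z} = {z \<in> Z. f z \<noteq> g z}" by blast
  ultimately show "closedin (zariski_topology (affine_coords {..<N}) Z) {z \<in> Z. f z = g z}"
    by (simp add: closedin_def)
qed

lemma separated_embedded:
  assumes inj: "\<And>x y. x \<in> X \<Longrightarrow> y \<in> X \<Longrightarrow> (\<And>c. c \<in> C \<Longrightarrow> c x = c y) \<Longrightarrow> x = y"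
  shows "separated (embedded_space C X)"
proof (rule separatedI)
  fix N Z f g a
  let ?Z = "embedded_space (affine_coords {..<N}) Z"
  assume fg: "morphism ?Z (embedded_space C X) f" "morphism ?Z (embedded_space C X) g"
    and a: "a \<in> Z" "f a \<noteq> g a"
  interpret Z: regular_space ?Z by (rule regular_space_embedded)
  have into: "f z \<in> X" "g z \<in> X" if "z \<in> Z" for z
    using morphism_into[OF fg(1)] morphism_into[OF fg(2)] that by auto
  obtain c where c: "c \<in> C" "c (f a) \<noteq> c (g a)" using inj into a by metis
  have "c \<in> reg (embedded_space C X) X"
    using polynomials_regular[OF polynomials.coord[OF c(1)] openin_topspace[of "zariski_topology C X"]]
    by simp
  then have "(\<lambda>z. c (f z)) \<in> reg ?Z {z \<in> Z. f z \<in> X}" "(\<lambda>z. c (g z)) \<in> reg ?Z {z \<in> Z. g z \<in> X}"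
    using morphism_regular[OF fg(1), of X c] morphism_regular[OF fg(2), of X c]
      openin_topspace[of "zariski_topology C X"] by simp_all
  moreover have "{z \<in> Z. f z \<in> X} = Z" "{z \<in> Z. g z \<in> X} = Z" using into by auto
  ultimately have "(\<lambda>z. c (f z) - c (g z)) \<in> reg ?Z Z"
    using Z.minus[of Z] openin_topspace[of "zar ?Z"] by simp
  then show "\<exists>W h. openin (zariski_topology (affine_coords {..<N}) Z) W \<and> a \<in> W \<and>
        h \<in> reg ?Z W \<and> h a \<noteq> 0 \<and> (\<forall>z\<in>W. f z = g z \<longrightarrow> h z = 0)"
    using a c openin_topspace[of "zar ?Z"]
    by (intro exI[of _ Z] exI[of _ "\<lambda>z. c (f z) - c (g z)"]) auto
qed

text \<open>The coordinates along the curve are rational with common denominator \<open>D\<close>,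
  so a polynomial in them becomes a polynomial in the parameter after multiplication by a power of
  \<open>D\<close>.\<close>

lemma polynomials_along_curve:
  fixes D :: "complex poly"
  assumes \<gamma>: "\<And>c. c \<in> C \<Longrightarrow> \<exists>P. \<forall>t. poly D t \<noteq> 0 \<longrightarrow> c (\<gamma> t) * poly D t = poly P t"
    and p: "p \<in> polynomials C"
  shows "\<exists>P k. \<forall>t. poly D t \<noteq> 0 \<longrightarrow> p (\<gamma> t) * poly D t ^ k = poly P t"
  using p
proof induction
  case (const a)
  show ?case by (rule exI[of _ "[:a:]"], rule exI[of _ 0]) simp
next
  case (coord c)
  then show ?case using \<gamma>[OF coord] by (metis power_one_right)
next
  case (add p q)
  then obtain P k Q l where
    "\<forall>t. poly D t \<noteq> 0 \<longrightarrow> p (\<gamma> t) * poly D t ^ k = poly P t"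
    "\<forall>t. poly D t \<noteq> 0 \<longrightarrow> q (\<gamma> t) * poly D t ^ l = poly Q t" by blast
  then have "\<forall>t. poly D t \<noteq> 0 \<longrightarrow> (p (\<gamma> t) + q (\<gamma> t)) * poly D t ^ (k + l) = poly (P * D ^ l + Q * D ^ k) t"
    by (auto simp: power_add algebra_simps simp flip: poly_power)
  then show ?case by blast
next
  case (mult p q)
  then obtain P k Q l where
    "\<forall>t. poly D t \<noteq> 0 \<longrightarrow> p (\<gamma> t) * poly D t ^ k = poly P t"
    "\<forall>t. poly D t \<noteq> 0 \<longrightarrow> q (\<gamma> t) * poly D t ^ l = poly Q t" by blast
  then have "\<forall>t. poly D t \<noteq> 0 \<longrightarrow> (p (\<gamma> t) * q (\<gamma> t)) * poly D t ^ (k + l) = poly (P * Q) t"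
    by (auto simp: power_add algebra_simps)
  then show ?case by blast
qed

text \<open>This takes the place of an irreducibility argument. A basic neighbourhood of
  \<open>x\<close> is given by some \<open>p\<close> with \<open>p x \<noteq> 0\<close>. Along the
  curve \<open>p\<close> is not identically zero because of t = 0, and \<open>q\<close> because of t
  = 1. The product of the resulting nonzero polynomials with \<open>D\<close> has a non-root, whose
  curve point lies in both open sets.\<close>

lemma principal_dense:
  assumes q: "q \<in> polynomials C"
    and curve: "\<And>x. x \<in> X \<Longrightarrow> \<exists>\<gamma> D. \<gamma> 0 = x \<and> poly D 0 \<noteq> 0 \<and> poly D 1 \<noteq> 0 \<and> q (\<gamma> 1) \<noteq> 0 \<and>
      (\<forall>t. poly D t \<noteq> 0 \<longrightarrow> \<gamma> t \<in> X) \<and>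
      (\<forall>c\<in>C. \<exists>P. \<forall>t. poly D t \<noteq> 0 \<longrightarrow> c (\<gamma> t) * poly D t = poly P t)"
  shows "zariski_topology C X closure_of {x \<in> X. q x \<noteq> 0} = X"
proof (rule antisym)
  show "zariski_topology C X closure_of {x \<in> X. q x \<noteq> 0} \<subseteq> X"
    using closure_of_subset_topspace[of "zariski_topology C X"] by simp
  show "X \<subseteq> zariski_topology C X closure_of {x \<in> X. q x \<noteq> 0}"
  proof
    fix x assume x: "x \<in> X"
    obtain \<gamma> D where \<gamma>: "\<gamma> 0 = x" "poly D 0 \<noteq> 0" "poly D 1 \<noteq> 0" "q (\<gamma> 1) \<noteq> 0"
      "\<forall>t. poly D t \<noteq> 0 \<longrightarrow> \<gamma> t \<in> X"
      "\<forall>c\<in>C. \<exists>P. \<forall>t. poly D t \<noteq> 0 \<longrightarrow> c (\<gamma> t) * poly D t = poly P t"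
      using curve[OF x] by (elim exE conjE) (rule that)
    have "\<exists>y. y \<in> {x \<in> X. q x \<noteq> 0} \<and> y \<in> T" if T: "x \<in> T" "openin (zariski_topology C X) T" for T
    proof -
      obtain p where p: "p \<in> polynomials C" "p x \<noteq> 0" "{z \<in> X. p z \<noteq> 0} \<subseteq> T"
        using openin_zariski_topologyE[OF T(2,1)] by auto
      obtain P k where P: "\<And>t. poly D t \<noteq> 0 \<Longrightarrow> p (\<gamma> t) * poly D t ^ k = poly P t"
        using polynomials_along_curve[of C D \<gamma>, OF bspec[OF \<gamma>(6)] p(1)] by blast
      obtain Q l where Q: "\<And>t. poly D t \<noteq> 0 \<Longrightarrow> q (\<gamma> t) * poly D t ^ l = poly Q t"
        using polynomials_along_curve[of C D \<gamma>, OF bspec[OF \<gamma>(6)] q] by blast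
      have "D \<noteq> 0" using \<gamma> by auto
      moreover have "P \<noteq> 0" using P[of 0] \<gamma> p by auto
      moreover have "Q \<noteq> 0" using Q[of 1] \<gamma> by auto
      ultimately have "D * P * Q \<noteq> 0" by simp
      then obtain t where t: "poly (D * P * Q) t \<noteq> 0" using poly_all_0_iff_0 by blast
      then have "\<gamma> t \<in> X" "p (\<gamma> t) \<noteq> 0" "q (\<gamma> t) \<noteq> 0"
        using spec[OF \<gamma>(5), of t] P[of t] Q[of t] by auto
      then show ?thesis using p by auto
    qed
    then show "x \<in> zariski_topology C X closure_of {x \<in> X. q x \<noteq> 0}"
      using x unfolding in_closure_of by simp
  qed
qed

subsection \<open>The minimal orbit\<close>

definition orbit_point :: "nat \<Rightarrow> (nat \<Rightarrow> complex) \<Rightarrow> (nat \<Rightarrow> complex) \<Rightarrow> complex mat" where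
  "orbit_point n u w = mat (n + 1) (n + 1) (\<lambda>(a, b). u a * w b - of_bool (a = b))"

lemma orbit_point_carrier [simp]: "orbit_point n u w \<in> carrier_mat (Suc n) (Suc n)"
  by (simp add: orbit_point_def)

lemma orbit_point_index [simp]:
  "a \<le> n \<Longrightarrow> b \<le> n \<Longrightarrow> orbit_point n u w $$ (a, b) = u a * w b - of_bool (a = b)"
  by (simp add: orbit_point_def)

lemma mult_mat_index:
  assumes "A \<in> carrier_mat m m" "B \<in> carrier_mat m m" "a < m" "b < m"
  shows "(A * B) $$ (a, b) = (\<Sum>c<m. A $$ (a, c) * B $$ (c, b))"
  using assms by (simp add: scalar_prod_def lessThan_atLeast0)

text \<open>\<open>H_0 + 1\<close> is n + 1 times the projection \<open>e_0 e_0^T\<close>.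
  Conjugation fixes the identity, so only column 0 of \<open>g\<close> and row 0 of its inverse
  survive.\<close>

lemma conj_minimal_element_index:
  assumes g: "g \<in> carrier_mat (n + 1) (n + 1)" "g' \<in> carrier_mat (n + 1) (n + 1)"
    and inv: "g * g' = 1\<^sub>m (n + 1)" and ab: "a \<le> n" "b \<le> n"
  shows "(g * minimal_element n * g') $$ (a, b) =
    of_nat (n + 1) * g $$ (a, 0) * g' $$ (0, b) - of_bool (a = b)"
proof -
  let ?f = "\<lambda>i. if i = 0 then of_nat n else - 1 :: complex"
  have eq: "g * minimal_element n = mat (n + 1) (n + 1) (\<lambda>(i, j). g $$ (i, j) * ?f j)"
    unfolding minimal_element_def by (rule mat_diag_mult_right[OF g(1)])
  have "(g * minimal_element n * g') $$ (a, b) = (\<Sum>c<n+1. g $$ (a, c) * ?f c * g' $$ (c, b))"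
    using g ab by (subst mult_mat_index[of _ "n + 1"]) (auto simp: eq intro!: sum.cong)
  also have "\<dots> = (\<Sum>c<n+1. of_bool (c = 0) * (of_nat (n + 1) * g $$ (a, 0) * g' $$ (0, b)) -
      g $$ (a, c) * g' $$ (c, b))"
    by (intro sum.cong) (auto simp: algebra_simps)
  also have "\<dots> = (\<Sum>c<n+1. of_bool (c = 0) * (of_nat (n + 1) * g $$ (a, 0) * g' $$ (0, b))) -
      (\<Sum>c<n+1. g $$ (a, c) * g' $$ (c, b))"
    by (rule sum_subtractf)
  also have "(\<Sum>c<n+1. g $$ (a, c) * g' $$ (c, b)) = of_bool (a = b)"
    using mult_mat_index[OF g, of a b] ab inv by auto
  also have "(\<Sum>c<n+1. of_bool (c = 0) * (of_nat (n + 1) * g $$ (a, 0) * g' $$ (0, b))) =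
      of_nat (n + 1) * g $$ (a, 0) * g' $$ (0, b)"
    by (subst sum.remove[of _ 0]) (auto intro!: sum.neutral)
  finally show ?thesis .
qed

text \<open>
  The matrix \<open>g = 1 + p y\<^sup>T\<close> maps the first basis vector to \<open>u\<close> and its inverse has first row
  \<open>w / (n + 1)\<close>.
\<close>

lemma orbit_point_conj_generic:
  fixes u w :: "nat \<Rightarrow> complex"
  assumes uw: "(\<Sum>a\<le>n. u a * w a) = of_nat (n + 1)" and u0: "u 0 \<noteq> 1" and w0: "w 0 \<noteq> of_nat (n + 1)"
  obtains g g' where "g \<in> carrier_mat (n + 1) (n + 1)" "g' \<in> carrier_mat (n + 1) (n + 1)"
    "g * g' = 1\<^sub>m (n + 1)" "\<And>a. a \<le> n \<Longrightarrow> g $$ (a, 0) = u a"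
    "\<And>b. b \<le> n \<Longrightarrow> of_nat (n + 1) * g' $$ (0, b) = w b"
proof -
  define m :: complex where "m = of_nat (n + 1)"
  define d where "d = m - w 0"
  \<comment> \<open>The inverse of \<open>1 + p y^T\<close> is \<open>1 - p y^T / \<kappa>\<close>
    with \<open>\<kappa> = 1 + y^T p\<close>. For its first row to be \<open>w / m\<close>, the
    vector \<open>y\<close> must be a multiple of \<open>m e_0 - w\<close>. Dividing by
    \<open>d\<close> gives \<open>y_0 = 1\<close>, so that the first column of \<open>g\<close> is
    \<open>e_0 + p = u\<close>. The two inequalities assumed on \<open>u 0\<close> and
    \<open>w 0\<close> keep \<open>\<kappa>\<close> and \<open>d\<close> nonzero.\<close>
  define y where "y b = (m * of_bool (b = 0) - w b) / d" for b
  define p where "p a = u a - of_bool (a = 0)" for a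
  define \<kappa> where "\<kappa> = m * (u 0 - 1) / d"
  have m0: "m \<noteq> 0" unfolding m_def by (simp del: of_nat_Suc)
  have d0: "d \<noteq> 0" using w0 unfolding d_def m_def by simp
  have \<kappa>0: "\<kappa> \<noteq> 0" using m0 d0 u0 unfolding \<kappa>_def by simp
  have y0: "y 0 = 1" unfolding y_def using d0 by (simp add: d_def)
  have yu: "(\<Sum>a\<le>n. y a * u a) = \<kappa>"
  proof -
    have "(\<Sum>a\<le>n. y a * u a) = (\<Sum>a\<le>n. of_bool (a = 0) * (m * u 0) / d - u a * w a / d)"
      by (intro sum.cong) (auto simp: y_def diff_divide_distrib left_diff_distrib)
    also have "\<dots> = (\<Sum>a\<le>n. of_bool (a = 0) * (m * u 0) / d) - (\<Sum>a\<le>n. u a * w a) / d"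
      by (simp add: sum_subtractf sum_divide_distrib)
    also have "(\<Sum>a\<le>n. of_bool (a = 0) * (m * u 0) / d) = m * u 0 / d"
      by (subst sum.remove[of _ 0]) (auto intro!: sum.neutral)
    finally show ?thesis unfolding uw \<kappa>_def m_def[symmetric] by (simp add: diff_divide_distrib algebra_simps)
  qed
  have yp: "(\<Sum>a\<le>n. y a * p a) = \<kappa> - 1"
  proof -
    have "(\<Sum>a\<le>n. y a * p a) = (\<Sum>a\<le>n. y a * u a) - (\<Sum>a\<le>n. of_bool (a = 0) * y a)"
      unfolding p_def by (simp add: sum_subtractf algebra_simps)
    also have "(\<Sum>a\<le>n. of_bool (a = 0) * y a) = y 0"
      by (subst sum.remove[of _ 0]) (auto intro!: sum.neutral)
    finally show ?thesis using yu y0 by simp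
  qed
  define g where "g = mat (n + 1) (n + 1) (\<lambda>(a, b). of_bool (a = b) + p a * y b)"
  define g' where "g' = mat (n + 1) (n + 1) (\<lambda>(a, b). of_bool (a = b) - p a * y b / \<kappa>)"
  have g: "g \<in> carrier_mat (n + 1) (n + 1)" "g' \<in> carrier_mat (n + 1) (n + 1)"
    by (auto simp: g_def g'_def)
  have "g * g' = 1\<^sub>m (n + 1)"
  proof (rule eq_matI)
    fix a b assume "a < dim_row (1\<^sub>m (n + 1) :: complex mat)" "b < dim_col (1\<^sub>m (n + 1) :: complex mat)"
    then have ab: "a \<le> n" "b \<le> n" by auto
    have "(g * g') $$ (a, b) =
        (\<Sum>c\<le>n. (of_bool (a = c) + p a * y c) * (of_bool (c = b) - p c * y b / \<kappa>))"
      using mult_mat_index[OF g, of a b] ab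
      by (auto simp: g_def g'_def lessThan_Suc_atMost intro!: sum.cong)
    also have "\<dots> = (\<Sum>c\<le>n. of_bool (c = a) * (of_bool (a = b) - p a * y b / \<kappa>) +
        of_bool (c = b) * (p a * y b) - (y c * p c) * (p a * y b / \<kappa>))"
      by (intro sum.cong) (auto simp: algebra_simps)
    also have "\<dots> = (\<Sum>c\<le>n. of_bool (c = a) * (of_bool (a = b) - p a * y b / \<kappa>)) +
        (\<Sum>c\<le>n. of_bool (c = b) * (p a * y b)) - (\<Sum>c\<le>n. y c * p c) * (p a * y b / \<kappa>)"
      unfolding sum_subtractf sum.distrib sum_distrib_right ..
    also have "(\<Sum>c\<le>n. of_bool (c = a) * (of_bool (a = b) - p a * y b / \<kappa>)) =
        of_bool (a = b) - p a * y b / \<kappa>"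
      by (subst sum.remove[of _ a]) (use ab in \<open>auto intro!: sum.neutral\<close>)
    also have "(\<Sum>c\<le>n. of_bool (c = b) * (p a * y b)) = p a * y b"
      by (subst sum.remove[of _ b]) (use ab in \<open>auto intro!: sum.neutral\<close>)
    finally have "(g * g') $$ (a, b) = of_bool (a = b)"
      unfolding yp using \<kappa>0 by (simp add: field_simps)
    then show "(g * g') $$ (a, b) = 1\<^sub>m (n + 1) $$ (a, b)" using ab by simp
  qed (use g in auto)
  moreover have "g $$ (a, 0) = u a" if "a \<le> n" for a
    using that y0 by (simp add: g_def p_def)
  moreover have "m * g' $$ (0, b) = w b" if "b \<le> n" for b
  proof -
    have "m * (p 0 * y b / \<kappa>) = m * of_bool (b = 0) - w b"
      using m0 d0 u0 unfolding p_def \<kappa>_def y_def by (simp add: field_simps)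
    then show ?thesis using that by (auto simp: g'_def right_diff_distrib)
  qed
  ultimately show thesis using that g unfolding m_def by blast
qed

text \<open>Replacing \<open>(u, w)\<close> by \<open>(s u, w / s)\<close> does not change the
  matrix and avoids the exceptional values of the generic case for all but finitely many
  \<open>s\<close>. The conjugating matrix found there may have any nonzero determinant. A scalar
  factor \<open>r\<close> cancels in the conjugation, and an (n + 1)-st root normalises the
  determinant to 1.\<close>

lemma orbit_point_in_orbit:
  assumes uw: "(\<Sum>a\<le>n. u a * w a) = of_nat (n + 1)"
  shows "orbit_point n u w \<in> adjoint_orbit (n + 1) (minimal_element n)"
proof -
  \<comment> \<open>If \<open>u 0 = 0\<close>, then \<open>1 / u 0\<close> is 0 by convention, and
    \<open>s * u 0 = 1\<close> is impossible anyway.\<close>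
  obtain s where s: "s \<notin> {0, 1 / u 0, w 0 / of_nat (n + 1)}"
    using ex_new_if_finite[OF infinite_UNIV_char_0, of "{0, 1 / u 0, w 0 / of_nat (n + 1)}"] by auto
  have s0: "s \<noteq> 0" using s by simp
  have "(\<Sum>a\<le>n. (s * u a) * (w a / s)) = of_nat (n + 1)" using s0 uw by simp
  moreover have "s * u 0 \<noteq> 1"
  proof
    assume *: "s * u 0 = 1"
    then have "u 0 \<noteq> 0" by auto
    then have "s = 1 / u 0" using * by (simp add: eq_divide_eq)
    then show False using s by simp
  qed
  moreover have "w 0 / s \<noteq> of_nat (n + 1)"
  proof
    assume "w 0 / s = of_nat (n + 1)"
    then have "s = w 0 / of_nat (n + 1)"
      using s0 by (simp add: divide_eq_eq eq_divide_eq mult.commute del: of_nat_Suc)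
    then show False using s by simp
  qed
  ultimately obtain g g' where g: "g \<in> carrier_mat (n + 1) (n + 1)" "g' \<in> carrier_mat (n + 1) (n + 1)"
    "g * g' = 1\<^sub>m (n + 1)" "\<And>a. a \<le> n \<Longrightarrow> g $$ (a, 0) = s * u a"
    "\<And>b. b \<le> n \<Longrightarrow> of_nat (n + 1) * g' $$ (0, b) = w b / s"
    using orbit_point_conj_generic[of "\<lambda>a. s * u a" "\<lambda>a. w a / s" n] by auto
  have "Determinant.det g * Determinant.det g' = 1"
    using det_mult[OF g(1,2)] g(3) by simp
  then have det: "Determinant.det g \<noteq> 0" by auto
  obtain r where r: "inverse (Determinant.det g) = r ^ (n + 1)"
    using exists_complex_root[of "n + 1"] by auto
  then have r0: "r \<noteq> 0" using det by auto
  let ?h = "r \<cdot>\<^sub>m g" and ?h' = "inverse r \<cdot>\<^sub>m g'"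
  have h: "?h \<in> carrier_mat (n + 1) (n + 1)" "?h' \<in> carrier_mat (n + 1) (n + 1)" using g by auto
  have "Determinant.det ?h = 1"
    using g(1) det r[symmetric] by (simp add: det_smult)
  moreover have hh: "?h * ?h' = 1\<^sub>m (n + 1)"
    using g(1-3) r0 by (intro eq_matI) (simp_all add: mult_smult_distrib[of _ "n+1" "n+1" _ "n+1"] mult_smult_assoc_mat[of _ "n+1" "n+1" _ "n+1"])
  moreover have "?h' * ?h = 1\<^sub>m (n + 1)"
    by (rule mat_mult_left_right_inverse[OF h hh])
  ultimately have "?h * minimal_element n * ?h' \<in> adjoint_orbit (n + 1) (minimal_element n)"
    using h unfolding adjoint_orbit_def by blast
  moreover have "?h * minimal_element n * ?h' = orbit_point n u w"
  proof (rule eq_matI)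
    fix a b assume "a < dim_row (orbit_point n u w)" "b < dim_col (orbit_point n u w)"
    then have ab: "a \<le> n" "b \<le> n" by (auto simp: orbit_point_def)
    have "of_nat (n + 1) * (r * g $$ (a, 0)) * (inverse r * g' $$ (0, b)) =
        g $$ (a, 0) * (of_nat (n + 1) * g' $$ (0, b))"
      using r0 by (simp add: field_simps)
    also have "\<dots> = u a * w b" unfolding g(4)[OF ab(1)] g(5)[OF ab(2)] using s by simp
    finally show "(?h * minimal_element n * ?h') $$ (a, b) = orbit_point n u w $$ (a, b)"
      using ab g(1,2) by (subst conj_minimal_element_index[OF h hh ab]) auto
  qed (use g in \<open>auto simp: orbit_point_def\<close>)
  ultimately show ?thesis by simp
qed

lemma adjoint_orbit_eq:
  "adjoint_orbit (n + 1) (minimal_element n) =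
    {orbit_point n u w | u w. (\<Sum>a\<le>n. u a * w a) = of_nat (n + 1)}"
proof (intro equalityI subsetI)
  fix A assume "A \<in> adjoint_orbit (n + 1) (minimal_element n)"
  then obtain g g' where A: "A = g * minimal_element n * g'"
    and g: "g \<in> carrier_mat (n + 1) (n + 1)" "g' \<in> carrier_mat (n + 1) (n + 1)"
    and inv: "g * g' = 1\<^sub>m (n + 1)" "g' * g = 1\<^sub>m (n + 1)"
    unfolding adjoint_orbit_def by auto
  let ?u = "\<lambda>a. of_nat (n + 1) * g $$ (a, 0)" and ?w = "\<lambda>b. g' $$ (0, b)"
  have "A = orbit_point n ?u ?w"
  proof (rule eq_matI)
    fix a b assume "a < dim_row (orbit_point n ?u ?w)" "b < dim_col (orbit_point n ?u ?w)"
    then have ab: "a \<le> n" "b \<le> n" by (auto simp: orbit_point_def)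
    show "A $$ (a, b) = orbit_point n ?u ?w $$ (a, b)"
      unfolding A using conj_minimal_element_index[OF g inv(1) ab] ab by simp
  qed (use A g in \<open>auto simp: orbit_point_def\<close>)
  moreover have "(\<Sum>a\<le>n. ?u a * ?w a) = of_nat (n + 1) * (g' * g) $$ (0, 0)"
    using mult_mat_index[OF g(2,1), of 0 0]
    by (simp add: sum_distrib_left lessThan_Suc_atMost algebra_simps)
  ultimately show "A \<in> {orbit_point n u w | u w. (\<Sum>a\<le>n. u a * w a) = of_nat (n + 1)}"
    using inv(2) by auto
qed (use orbit_point_in_orbit in auto)

lemma adjoint_orbit_carrier:
  "A \<in> adjoint_orbit (n + 1) (minimal_element n) \<Longrightarrow> A \<in> carrier_mat (n + 1) (n + 1)"
  unfolding adjoint_orbit_eq by auto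

section \<open>Equations of the orbit and its affineness\<close>

definition shift :: "complex mat \<Rightarrow> nat \<Rightarrow> nat \<Rightarrow> complex" where
  "shift A a b = A $$ (a, b) + of_bool (a = b)"

lemma shift_orbit_point [simp]: "a \<le> n \<Longrightarrow> b \<le> n \<Longrightarrow> shift (orbit_point n u w) a b = u a * w b"
  by (simp add: shift_def)

text \<open>The vanishing 2 x 2 minors of \<open>A + 1\<close> say that its rank is at most one. Its
  nonzero trace supplies a nonzero diagonal entry at some \<open>e\<close>, and column
  \<open>e\<close> together with row \<open>e\<close> divided by that pivot recover \<open>u\<close>
  and \<open>w\<close>. Being cut out by equations, the orbit is closed in the space of
  matrices.\<close>

lemma adjoint_orbit_iff_equations:
  "A \<in> adjoint_orbit (n + 1) (minimal_element n) \<longleftrightarrow> A \<in> carrier_mat (n + 1) (n + 1) \<and>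
     (\<Sum>a\<le>n. shift A a a) = of_nat (n + 1) \<and>
     (\<forall>a\<le>n. \<forall>b\<le>n. \<forall>c\<le>n. \<forall>d\<le>n. shift A a b * shift A c d = shift A a d * shift A c b)"
proof
  assume "A \<in> adjoint_orbit (n + 1) (minimal_element n)"
  then show "A \<in> carrier_mat (n + 1) (n + 1) \<and>
     (\<Sum>a\<le>n. shift A a a) = of_nat (n + 1) \<and>
     (\<forall>a\<le>n. \<forall>b\<le>n. \<forall>c\<le>n. \<forall>d\<le>n. shift A a b * shift A c d = shift A a d * shift A c b)"
    unfolding adjoint_orbit_eq by auto
next
  assume *: "A \<in> carrier_mat (n + 1) (n + 1) \<and>
     (\<Sum>a\<le>n. shift A a a) = of_nat (n + 1) \<and>
     (\<forall>a\<le>n. \<forall>b\<le>n. \<forall>c\<le>n. \<forall>d\<le>n. shift A a b * shift A c d = shift A a d * shift A c b)"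
  then have "(\<Sum>a\<le>n. shift A a a) \<noteq> 0" by (simp del: of_nat_Suc)
  then obtain e where e: "e \<le> n" "shift A e e \<noteq> 0"
    by (meson atMost_iff sum.not_neutral_contains_not_neutral)
  let ?u = "\<lambda>a. shift A a e" and ?w = "\<lambda>b. shift A e b / shift A e e"
  have uw: "?u a * ?w b = shift A a b" if "a \<le> n" "b \<le> n" for a b
  proof -
    have "shift A a b * shift A e e = shift A a e * shift A e b" using * that e(1) by blast
    then show ?thesis using e(2) by (simp add: divide_eq_eq)
  qed
  have "A = orbit_point n ?u ?w"
  proof (rule eq_matI)
    fix a b assume "a < dim_row (orbit_point n ?u ?w)" "b < dim_col (orbit_point n ?u ?w)"
    then have ab: "a \<le> n" "b \<le> n" by (auto simp: orbit_point_def)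
    then have "orbit_point n ?u ?w $$ (a, b) = ?u a * ?w b - of_bool (a = b)" by (rule orbit_point_index)
    then show "A $$ (a, b) = orbit_point n ?u ?w $$ (a, b)"
      unfolding uw[OF ab] by (simp add: shift_def)
  qed (use * in \<open>auto simp: orbit_point_def\<close>)
  moreover have "(\<Sum>a\<le>n. ?u a * ?w a) = of_nat (n + 1)"
    using uw * by simp
  ultimately show "A \<in> adjoint_orbit (n + 1) (minimal_element n)"
    unfolding adjoint_orbit_eq by blast
qed

lemma mat_coords_polynomial:
  "a < m \<Longrightarrow> b < m \<Longrightarrow> (\<lambda>A. A $$ (a, b)) \<in> polynomials (mat_coords m)"
  by (rule polynomials.coord) (auto simp: mat_coords_def)

lemma mat_coordsE:
  assumes "c \<in> mat_coords (n + 1)"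
  obtains a b where "a \<le> n" "b \<le> n" "c = (\<lambda>A. A $$ (a, b))"
  using assms unfolding mat_coords_def by (auto simp: less_Suc_eq_le)

lemma shift_polynomial:
  assumes "a < m" "b < m"
  shows "(\<lambda>A. shift A a b) \<in> polynomials (mat_coords m)"
  unfolding shift_def
  by (intro polynomials.add mat_coords_polynomial polynomials.const assms)

lemma closedin_zeros:
  assumes "S \<subseteq> polynomials C"
  shows "closedin (zariski_topology C X) {x \<in> X. \<forall>p\<in>S. p x = 0}"
proof -
  have "X - {x \<in> X. \<forall>p\<in>S. p x = 0} = (\<Union>p\<in>S. {x \<in> X. p x \<noteq> 0})" by auto
  moreover have "openin (zariski_topology C X) (\<Union>p\<in>S. {x \<in> X. p x \<noteq> 0})"
    using assms by (intro openin_Union) (auto intro: openin_principal)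
  ultimately show ?thesis by (auto simp: closedin_def)
qed

text \<open>A closed subset of the space of matrices is affine, so a cover by one chart suffices.
  Row-major numbering, with entry (a, b) at position \<open>a * (n + 1) + b\<close>, turns matrices
  into points of affine space.\<close>

lemma variety_orbit: "variety (orbit_variety (n + 1) (minimal_element n))"
proof -
  let ?m = "n + 1"
  let ?N = "?m * ?m"
  let ?C = "mat_coords ?m" and ?X = "adjoint_orbit ?m (minimal_element n)"
  let ?K = "affine_coords {..<?N}"
  let ?G = "\<lambda>v. mat ?m ?m (\<lambda>(a, b). v (a * ?m + b)) :: complex mat"
  have lt: "a * ?m + b < ?N" if "a \<le> n" "b \<le> n" for a b
  proof -
    have "a * ?m \<le> n * ?m" using that(1) by (rule mult_le_mono1)
    then show ?thesis using that(2) by simp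
  qed
  have K: "(\<lambda>v. v (a * ?m + b)) \<in> polynomials ?K" if "a \<le> n" "b \<le> n" for a b
    using lt[OF that] by (intro polynomials.coord) (auto simp: affine_coords_def)
  define s where "s a b = (\<lambda>v :: nat \<Rightarrow> complex. v (a * ?m + b) + of_bool (a = b))" for a b
  have s: "s a b \<in> polynomials ?K" if "a \<le> n" "b \<le> n" for a b
    unfolding s_def using that by (intro polynomials.add K polynomials.const)
  have shift_G: "shift (?G v) a b = s a b v" if "a \<le> n" "b \<le> n" for a b v
    using that by (simp add: shift_def s_def)
  let ?Z = "{v \<in> affine_points {..<?N}. ?G v \<in> ?X}"
  define S where "S = insert (\<lambda>v. (\<Sum>a\<le>n. s a a v) - of_nat (n + 1))
    (\<Union>a\<in>{..n}. \<Union>b\<in>{..n}. \<Union>c\<in>{..n}. \<Union>d\<in>{..n}. {\<lambda>v. s a b v * s c d v - s a d v * s c b v})"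
  have "?G v \<in> ?X \<longleftrightarrow> (\<forall>p\<in>S. p v = 0)" for v
  proof -
    have "(\<Sum>a\<le>n. shift (?G v) a a) = (\<Sum>a\<le>n. s a a v)"
      by (intro sum.cong refl shift_G) auto
    moreover have "(\<forall>a\<le>n. \<forall>b\<le>n. \<forall>c\<le>n. \<forall>d\<le>n. shift (?G v) a b * shift (?G v) c d =
        shift (?G v) a d * shift (?G v) c b) \<longleftrightarrow>
      (\<forall>a\<le>n. \<forall>b\<le>n. \<forall>c\<le>n. \<forall>d\<le>n. s a b v * s c d v = s a d v * s c b v)"
      by (simp only: shift_G cong: imp_cong)
    moreover have "?G v \<in> carrier_mat ?m ?m" by simp
    ultimately show ?thesis
      unfolding adjoint_orbit_iff_equations S_def ball_simps ball_UN right_minus_eq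
      unfolding Ball_def atMost_iff by simp
  qed
  then have Z_eq: "?Z = {v \<in> affine_points {..<?N}. \<forall>p\<in>S. p v = 0}" by simp
  have "S \<subseteq> polynomials ?K"
    unfolding S_def
    by (intro insert_subsetI UN_least empty_subsetI polynomials_minus polynomials_sum polynomials.mult s
        polynomials.const) simp_all
  then have Z: "algebraic_subset ?N ?Z"
    unfolding algebraic_subset_def Z_eq by (rule closedin_zeros)
  have "affine_variety (embedded_space ?C ?X)"
  proof (rule affine_varietyI[OF Z, where G = ?G and d = "\<lambda>i A. A $$ (i div ?m, i mod ?m)"])
    show "(\<lambda>A. A $$ (i div ?m, i mod ?m)) \<in> polynomials ?C" if "i < ?N" for i
      using that by (intro mat_coords_polynomial) (auto simp: less_mult_imp_div_less)
    show "(\<lambda>v. c (?G v)) \<in> polynomials ?K" if "c \<in> ?C" for c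
    proof -
      obtain a b where "a \<le> n" "b \<le> n" "c = (\<lambda>A. A $$ (a, b))"
        using mat_coordsE[OF \<open>c \<in> mat_coords (n + 1)\<close>] by metis
      then show ?thesis using K by simp
    qed
    have GF: "?G (\<lambda>i\<in>{..<?N}. A $$ (i div ?m, i mod ?m)) = A" if "A \<in> ?X" for A
    proof (rule eq_matI)
      fix a b assume "a < dim_row A" "b < dim_col A"
      then have ab: "a \<le> n" "b \<le> n" using adjoint_orbit_carrier[OF that] by auto
      then have "(a * ?m + b) div ?m = a" "(a * ?m + b) mod ?m = b"
        by (simp_all only: div_mult_self3 mod_mult_self3) auto
      then show "?G (\<lambda>i\<in>{..<?N}. A $$ (i div ?m, i mod ?m)) $$ (a, b) = A $$ (a, b)"
        using ab lt[OF ab] by (simp del: mult_Suc mult_Suc_right)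
    qed (use adjoint_orbit_carrier[OF that] in auto)
    then show "?G (\<lambda>i\<in>{..<?N}. A $$ (i div ?m, i mod ?m)) = A" if "A \<in> ?X" for A
      using that by blast
    show "(\<lambda>i\<in>{..<?N}. A $$ (i div ?m, i mod ?m)) \<in> ?Z" if "A \<in> ?X" for A
      using GF[OF that] that by (auto simp: affine_points_def)
    show "(\<lambda>i\<in>{..<?N}. ?G v $$ (i div ?m, i mod ?m)) = v" if "v \<in> ?Z" for v
    proof
      fix i
      show "(\<lambda>i\<in>{..<?N}. ?G v $$ (i div ?m, i mod ?m)) i = v i"
      proof (cases "i < ?N")
        case True
        then have "i div ?m < ?m" "i mod ?m < ?m" by (auto simp: less_mult_imp_div_less)
        then have "?G v $$ (i div ?m, i mod ?m) = v (i div ?m * ?m + i mod ?m)" by simp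
        then show ?thesis using True by (simp only: div_mult_mod_eq restrict_apply lessThan_iff if_True)
      next
        case False
        then show ?thesis using that by (auto simp: affine_points_def PiE_def extensional_def)
      qed
    qed
  qed auto
  then have "affine_variety (open_subspace (embedded_space ?C ?X) ?X)"
    by (simp add: open_subspace_def embedded_space_def
        subtopology_topspace[of "zariski_topology ?C ?X", simplified])
  moreover have "separated (embedded_space ?C ?X)"
  proof (rule separated_embedded)
    fix A B assume AB: "A \<in> ?X" "B \<in> ?X" and eq: "\<And>c. c \<in> ?C \<Longrightarrow> c A = c B"
    show "A = B"
    proof (rule eq_matI)
      fix a b assume "a < dim_row B" "b < dim_col B"
      then have "(\<lambda>A. A $$ (a, b)) \<in> ?C"
        using adjoint_orbit_carrier[OF AB(2)] by (auto simp: mat_coords_def)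
      then show "A $$ (a, b) = B $$ (a, b)" using eq by blast
    qed (use adjoint_orbit_carrier[OF AB(1)] adjoint_orbit_carrier[OF AB(2)] in auto)
  qed
  moreover have "function_sheaf (embedded_space ?C ?X)"
    using regular_space_embedded by (rule regular_space.sheaf)
  ultimately show ?thesis
    unfolding variety_def orbit_variety_def using openin_topspace[of "zariski_topology ?C ?X"]
    by (intro conjI exI[of _ "{?X}"]) simp_all
qed

section \<open>The dense cell and the height functions of the orbit\<close>

lemma orbit_open_dense:
  "zariski_topology (mat_coords (n + 1)) (adjoint_orbit (n + 1) (minimal_element n)) closure_of
     {A \<in> adjoint_orbit (n + 1) (minimal_element n). shift A 0 0 \<noteq> 0} =
   adjoint_orbit (n + 1) (minimal_element n)"
proof (rule principal_dense)
  show "(\<lambda>A. shift A 0 0) \<in> polynomials (mat_coords (n + 1))" by (rule shift_polynomial) auto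
next
  define m :: complex where "m = of_nat (n + 1)"
  have m0: "m \<noteq> 0" unfolding m_def by (simp del: of_nat_Suc)
  fix A assume "A \<in> adjoint_orbit (n + 1) (minimal_element n)"
  then obtain u w where A: "A = orbit_point n u w" and uw: "(\<Sum>a\<le>n. u a * w a) = m"
    unfolding adjoint_orbit_eq m_def by auto
  \<comment> \<open>Segments from \<open>u\<close> to \<open>e_0\<close> and from \<open>w\<close>
    to \<open>m e_0\<close>. The pairing varies along them, so \<open>w\<close> is divided by
    \<open>D\<close>, the pairing divided by \<open>m\<close>. This keeps the curve in the orbit
    wherever \<open>D\<close> is nonzero. At both ends \<open>D\<close> is 1, and at t = 1 the pivot
    \<open>shift (\<gamma> 1) 0 0\<close> is \<open>m\<close>.\<close>
  define U where "U a = [:u a, of_bool (a = 0) - u a:]" for a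
  define W where "W a = [:w a, m * of_bool (a = 0) - w a:]" for a
  define D where "D = Polynomial.smult (1 / m) (\<Sum>a\<le>n. U a * W a)"
  define \<gamma> where "\<gamma> t = orbit_point n (\<lambda>a. poly (U a) t) (\<lambda>b. poly (W b) t / poly D t)" for t
  have D: "poly D t = (\<Sum>a\<le>n. poly (U a) t * poly (W a) t) / m" for t
    by (simp add: D_def poly_sum)
  have D0: "poly D 0 = 1" unfolding D using uw m0 by (simp add: U_def W_def)
  have "(\<Sum>a\<le>n. of_bool (a = 0) * (m * of_bool (a = 0))) = m"
    by (subst sum.remove[of _ 0]) (auto intro!: sum.neutral)
  then have D1: "poly D 1 = 1" unfolding D using m0 by (simp add: U_def W_def)
  have "\<gamma> 0 = A" unfolding \<gamma>_def A D0 by (simp add: U_def W_def)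
  moreover have "shift (\<gamma> 1) 0 0 \<noteq> 0" unfolding \<gamma>_def using m0 by (simp add: D1 U_def W_def)
  moreover have "\<gamma> t \<in> adjoint_orbit (n + 1) (minimal_element n)" if "poly D t \<noteq> 0" for t
  proof -
    have "(\<Sum>a\<le>n. poly (U a) t * (poly (W a) t / poly D t)) = (poly D t * m) / poly D t"
      using m0 unfolding times_divide_eq_right sum_divide_distrib[symmetric] by (simp add: D)
    then show ?thesis unfolding \<gamma>_def using that by (intro orbit_point_in_orbit) (simp add: m_def)
  qed
  moreover have "\<exists>P. \<forall>t. poly D t \<noteq> 0 \<longrightarrow> c (\<gamma> t) * poly D t = poly P t"
    if "c \<in> mat_coords (n + 1)" for c
  proof -
    obtain a b where ab: "a \<le> n" "b \<le> n" "c = (\<lambda>A. A $$ (a, b))"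
      using mat_coordsE[OF \<open>c \<in> mat_coords (n + 1)\<close>] by metis
    have "c (\<gamma> t) * poly D t = poly (U a * W b - Polynomial.smult (of_bool (a = b)) D) t" if "poly D t \<noteq> 0" for t
      using ab that by (simp add: \<gamma>_def algebra_simps)
    then show ?thesis by blast
  qed
  ultimately show "\<exists>\<gamma> D. \<gamma> 0 = A \<and> poly D 0 \<noteq> 0 \<and> poly D 1 \<noteq> 0 \<and> shift (\<gamma> 1) 0 0 \<noteq> 0 \<and>
      (\<forall>t. poly D t \<noteq> 0 \<longrightarrow> \<gamma> t \<in> adjoint_orbit (n + 1) (minimal_element n)) \<and>
      (\<forall>c\<in>mat_coords (n + 1). \<exists>P. \<forall>t. poly D t \<noteq> 0 \<longrightarrow> c (\<gamma> t) * poly D t = poly P t)"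
    using D0 D1 by (intro exI[of _ \<gamma>] exI[of _ D]) auto
qed

lemma height_mat_diag:
  assumes "A \<in> carrier_mat m m"
  shows "height (mat_diag m f) A = (\<Sum>i<m. f i * A $$ (i, i))"
  unfolding height_def mat_trace_def using mat_diag_mult_left[OF assms, of f] by simp

lemma landau_ginzburg_orbit:
  "landau_ginzburg (orbit_variety (n + 1) (minimal_element n)) (height (mat_diag (n + 1) f))"
proof -
  let ?X = "adjoint_orbit (n + 1) (minimal_element n)"
  interpret X: regular_space "embedded_space (mat_coords (n + 1)) ?X" by (rule regular_space_embedded)
  have "(\<lambda>A. \<Sum>i<n+1. f i * A $$ (i, i)) \<in> polynomials (mat_coords (n + 1))"
    by (intro polynomials_sum polynomials.mult polynomials.const mat_coords_polynomial) auto
  from polynomials_regular[OF this openin_topspace[of "zariski_topology (mat_coords (n + 1)) ?X"]]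
  have "(\<lambda>A. \<Sum>i<n+1. f i * A $$ (i, i)) \<in> reg (embedded_space (mat_coords (n + 1)) ?X) ?X" by simp
  then have "height (mat_diag (n + 1) f) \<in> reg (embedded_space (mat_coords (n + 1)) ?X) ?X"
    using openin_topspace[of "zariski_topology (mat_coords (n + 1)) ?X"] adjoint_orbit_carrier
    by (rule_tac X.cong) (auto simp: height_mat_diag simp del: sum.lessThan_Suc)
  then show ?thesis
    using variety_orbit unfolding landau_ginzburg_def orbit_variety_def by simp
qed

subsection \<open>Charts of the cotangent bundle\<close>

lemma points_glue: "points (glue J Y \<psi>) = (\<Union>j\<in>J. \<psi> j ` points (Y j))"
proof
  show "points (glue J Y \<psi>) \<subseteq> (\<Union>j\<in>J. \<psi> j ` points (Y j))"
    using openin_topspace[of "zar (glue J Y \<psi>)"] unfolding openin_glue by simp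
  have "openin (zar (Y j)) {p \<in> points (Y j). \<psi> j p \<in> (\<Union>j\<in>J. \<psi> j ` points (Y j))}" if "j \<in> J" for j
  proof -
    have "{p \<in> points (Y j). \<psi> j p \<in> (\<Union>j\<in>J. \<psi> j ` points (Y j))} = points (Y j)"
      using that by auto
    then show ?thesis by simp
  qed
  then have "openin (zar (glue J Y \<psi>)) (\<Union>j\<in>J. \<psi> j ` points (Y j))"
    unfolding openin_glue by simp
  then show "(\<Union>j\<in>J. \<psi> j ` points (Y j)) \<subseteq> points (glue J Y \<psi>)" by (rule openin_subset)
qed

lemma reg_glue_iff:
  "f \<in> reg (glue J Y \<psi>) U \<longleftrightarrow> (\<forall>j\<in>J. (\<lambda>p. f (\<psi> j p)) \<in> reg (Y j) {p \<in> points (Y j). \<psi> j p \<in> U})"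
  by (simp add: glue_def comp_def)

lemma openin_glueD:
  "openin (zar (glue J Y \<psi>)) U \<Longrightarrow> j \<in> J \<Longrightarrow> openin (zar (Y j)) {p \<in> points (Y j). \<psi> j p \<in> U}"
  unfolding openin_glue by simp

text \<open>Openness and regularity on the glued space are both defined by pulling back to the
  charts, so each axiom is inherited chart by chart.\<close>

lemma regular_space_glue:
  assumes Y: "\<And>j. j \<in> J \<Longrightarrow> regular_space (Y j)"
  shows "regular_space (glue J Y \<psi>)"
proof
  show "function_sheaf (glue J Y \<psi>)"
    unfolding function_sheaf_def
  proof (intro conjI allI impI)
    fix U V f
    assume *: "openin (zar (glue J Y \<psi>)) U \<and> openin (zar (glue J Y \<psi>)) V \<and> V \<subseteq> U \<and> f \<in> reg (glue J Y \<psi>) U"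
    show "f \<in> reg (glue J Y \<psi>) V"
      unfolding reg_glue_iff
    proof
      fix j assume j: "j \<in> J"
      show "(\<lambda>p. f (\<psi> j p)) \<in> reg (Y j) {p \<in> points (Y j). \<psi> j p \<in> V}"
      proof (rule regular_space.restrict[OF Y[OF j]])
        show "(\<lambda>p. f (\<psi> j p)) \<in> reg (Y j) {p \<in> points (Y j). \<psi> j p \<in> U}"
          using * j unfolding reg_glue_iff by simp
      qed (use * openin_glueD[OF _ j] in auto)
    qed
  next
    fix U f
    assume *: "openin (zar (glue J Y \<psi>)) U \<and> (\<forall>p\<in>U. \<exists>V g. openin (zar (glue J Y \<psi>)) V \<and>
      p \<in> V \<and> V \<subseteq> U \<and> g \<in> reg (glue J Y \<psi>) V \<and> (\<forall>q\<in>V. f q = g q))"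
    show "f \<in> reg (glue J Y \<psi>) U"
      unfolding reg_glue_iff
    proof
      fix j assume j: "j \<in> J"
      show "(\<lambda>p. f (\<psi> j p)) \<in> reg (Y j) {p \<in> points (Y j). \<psi> j p \<in> U}"
      proof (rule regular_space.local[OF Y[OF j]])
        fix p assume p: "p \<in> {p \<in> points (Y j). \<psi> j p \<in> U}"
        then obtain V g where V: "openin (zar (glue J Y \<psi>)) V" "\<psi> j p \<in> V" "V \<subseteq> U"
            "g \<in> reg (glue J Y \<psi>) V" "\<forall>q\<in>V. f q = g q"
          using bspec[OF conjunct2[OF *], of "\<psi> j p"] by auto
        show "\<exists>W h. openin (zar (Y j)) W \<and> p \<in> W \<and> W \<subseteq> {p \<in> points (Y j). \<psi> j p \<in> U} \<and>
            h \<in> reg (Y j) W \<and> (\<forall>q\<in>W. f (\<psi> j q) = h q)"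
          using p V openin_glueD[OF V(1) j] bspec[OF iffD1[OF reg_glue_iff V(4)] j]
          by (intro exI[of _ "{p \<in> points (Y j). \<psi> j p \<in> V}"] exI[of _ "\<lambda>p. g (\<psi> j p)"]) auto
      qed (use * openin_glueD[OF _ j] in auto)
    qed
  qed
next
  fix U f assume U: "openin (zar (glue J Y \<psi>)) U" and f: "f \<in> reg (glue J Y \<psi>) U"
  show "openin (zar (glue J Y \<psi>)) {z \<in> U. f z \<noteq> 0}"
    unfolding openin_glue
  proof (intro conjI ballI)
    show "{z \<in> U. f z \<noteq> 0} \<subseteq> (\<Union>j\<in>J. \<psi> j ` points (Y j))"
      using U unfolding openin_glue by auto
    fix j assume j: "j \<in> J"
    have "{p \<in> points (Y j). \<psi> j p \<in> {z \<in> U. f z \<noteq> 0}} =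
        {p \<in> {p \<in> points (Y j). \<psi> j p \<in> U}. f (\<psi> j p) \<noteq> 0}" by auto
    then show "openin (zar (Y j)) {p \<in> points (Y j). \<psi> j p \<in> {z \<in> U. f z \<noteq> 0}}"
      using regular_space.nonzero_open[OF Y[OF j] openin_glueD[OF U j] bspec[OF iffD1[OF reg_glue_iff f] j]]
      by simp
  qed
  assume nz: "\<And>z. z \<in> U \<Longrightarrow> f z \<noteq> 0"
  show "(\<lambda>z. inverse (f z)) \<in> reg (glue J Y \<psi>) U"
    unfolding reg_glue_iff
  proof
    fix j assume j: "j \<in> J"
    show "(\<lambda>p. inverse (f (\<psi> j p))) \<in> reg (Y j) {p \<in> points (Y j). \<psi> j p \<in> U}"
      using nz
      by (intro regular_space.inverse[OF Y[OF j] openin_glueD[OF U j] bspec[OF iffD1[OF reg_glue_iff f] j]]) auto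
  qed
next
  fix U f g assume U: "openin (zar (glue J Y \<psi>)) U" and f: "f \<in> reg (glue J Y \<psi>) U"
    and g: "g \<in> reg (glue J Y \<psi>) U"
  show "(\<lambda>z. f z + g z) \<in> reg (glue J Y \<psi>) U"
    unfolding reg_glue_iff
    by (intro ballI regular_space.add[OF Y openin_glueD[OF U]]
        bspec[OF iffD1[OF reg_glue_iff f]] bspec[OF iffD1[OF reg_glue_iff g]])
  show "(\<lambda>z. f z * g z) \<in> reg (glue J Y \<psi>) U"
    unfolding reg_glue_iff
    by (intro ballI regular_space.mult[OF Y openin_glueD[OF U]]
        bspec[OF iffD1[OF reg_glue_iff f]] bspec[OF iffD1[OF reg_glue_iff g]])
next
  fix U and a :: complex assume U: "openin (zar (glue J Y \<psi>)) U"
  show "(\<lambda>_. a) \<in> reg (glue J Y \<psi>) U"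
    unfolding reg_glue_iff
    by (intro ballI regular_space.const[OF Y openin_glueD[OF U]])
qed

lemma morphism_glue_chart:
  assumes j: "j \<in> J"
  shows "morphism (Y j) (glue J Y \<psi>) (\<psi> j)"
  unfolding morphism_def
proof (intro conjI allI impI ballI)
  show "continuous_map (zar (Y j)) (zar (glue J Y \<psi>)) (\<psi> j)"
    unfolding continuous_map_def points_glue using openin_glueD[OF _ j] j by auto
next
  fix V f assume "f \<in> reg (glue J Y \<psi>) V"
  then show "f \<circ> \<psi> j \<in> reg (Y j) {p \<in> points (Y j). \<psi> j p \<in> V}"
    using bspec[OF iffD1[OF reg_glue_iff] j] by (simp add: comp_def)
qed

section \<open>Homogeneous coordinates and the gluing relation\<close>

definition chart_set :: "nat \<Rightarrow> nat \<Rightarrow> chart_point set" where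
  "chart_set n j = affine_points (chart_index n j) \<times> affine_points (chart_index n j)"

definition chart_coords :: "nat \<Rightarrow> nat \<Rightarrow> (chart_point \<Rightarrow> complex) set" where
  "chart_coords n j =
     {\<lambda>(x, y). x i | i. i \<in> chart_index n j} \<union> {\<lambda>(x, y). y i | i. i \<in> chart_index n j}"

lemma cotangent_chart_space_eq:
  "cotangent_chart_space n j = embedded_space (chart_coords n j) (chart_set n j)"
  by (simp add: cotangent_chart_space_def chart_coords_def chart_set_def)

lemma points_chart_space [simp]: "points (cotangent_chart_space n j) = chart_set n j"
  by (simp add: cotangent_chart_space_eq)

lemma finite_chart_index [simp]: "finite (chart_index n j)"
  by (simp add: chart_index_def)

lemma chart_index_iff: "i \<in> chart_index n j \<longleftrightarrow> i \<le> n \<and> i \<noteq> j"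
  by (auto simp: chart_index_def)

text \<open>
  Homogeneous coordinates: a point of \<open>T\<^sup>*\<P>\<^sup>n\<close> is a class of pairs \<open>(v, \<xi>)\<close> with \<open>v \<noteq> 0\<close> and
  \<open>\<Sum> v\<^sub>a \<xi>\<^sub>a = 0\<close> modulo \<open>(v, \<xi>) \<sim> (c v, \<xi> / c)\<close>; the chart \<open>V\<^sub>j\<close> is the slice \<open>v\<^sub>j = 1\<close>.
\<close>

definition hvec :: "nat \<Rightarrow> chart_point \<Rightarrow> nat \<Rightarrow> complex" where
  "hvec j p = (fst p)(j := 1)"

text \<open>The covector is the pull-back of \<open>\<Sum> y_i dx_i\<close> along
  \<open>v \<mapsto> v / v_j\<close>, taken at \<open>v_j = 1\<close>. Since
  \<open>dx_i = dv_i - x_i dv_j\<close> there, the coefficient of \<open>dv_j\<close> is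
  \<open>- \<Sum> x_i y_i\<close>.\<close>

definition hcov :: "nat \<Rightarrow> nat \<Rightarrow> chart_point \<Rightarrow> nat \<Rightarrow> complex" where
  "hcov n j p = (snd p)(j := - (\<Sum>l\<in>chart_index n j. fst p l * snd p l))"

lemma hvec_self [simp]: "hvec j p j = 1"
  by (simp add: hvec_def)

lemma sum_hvec_hcov:
  assumes "j \<le> n"
  shows "(\<Sum>a\<le>n. hvec j p a * hcov n j p a) = 0"
proof -
  have "(\<Sum>a\<le>n. hvec j p a * hcov n j p a) =
      hvec j p j * hcov n j p j + (\<Sum>a\<in>{..n} - {j}. hvec j p a * hcov n j p a)"
    using assms by (intro sum.remove) auto
  also have "(\<Sum>a\<in>{..n} - {j}. hvec j p a * hcov n j p a) = (\<Sum>l\<in>chart_index n j. fst p l * snd p l)"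
    by (intro sum.cong) (auto simp: chart_index_def hvec_def hcov_def)
  finally show ?thesis by (simp add: hcov_def)
qed

text \<open>This is the quotient rule for \<open>v_l / v_k\<close>. As \<open>i \<noteq> j\<close>,
  moving \<open>x_i\<close> stays in the slice \<open>v_j = 1\<close>; as
  \<open>l \<noteq> k\<close>, the numerator is not the denominator.\<close>

lemma transition_jacobian_eq:
  assumes "i \<in> chart_index n j" "l \<in> chart_index n k" and nz: "hvec j (x, y) k \<noteq> 0"
  shows "transition_jacobian n j k x l i =
    of_bool (l = i) / hvec j (x, y) k - of_bool (i = k) * hvec j (x, y) l / hvec j (x, y) k ^ 2"
proof -
  define v where "v = hvec j (x, y)"
  have ij: "i \<noteq> j" and lk: "l \<noteq> k" using assms by (auto simp: chart_index_iff)
  have "(\<lambda>t. transition n j k (x(i := t)) l) = (\<lambda>t. (v(i := t)) l / (v(i := t)) k)"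
    using assms(2) ij by (auto simp: transition_def v_def hvec_def fun_upd_twist)
  moreover have "((\<lambda>t. (v(i := t)) l / (v(i := t)) k) has_field_derivative
      (of_bool (l = i) / v k - of_bool (i = k) * v l / v k ^ 2)) (at (x i))"
  proof (cases "i = k")
    case True
    have "x i = v i" using ij by (simp add: v_def hvec_def)
    then show ?thesis
      using True lk nz unfolding v_def[symmetric]
      by (auto intro!: derivative_eq_intros simp: power2_eq_square)
  next
    case False
    show ?thesis
    proof (cases "l = i")
      case True
      then show ?thesis using False nz unfolding v_def[symmetric]
        by (auto intro!: derivative_eq_intros)
    next
      case neq: False
      then show ?thesis using False by simp
    qed
  qed
  ultimately show ?thesis
    unfolding transition_jacobian_def v_def[symmetric] by (simp add: DERIV_imp_deriv)
qed

definition same_point :: "nat \<Rightarrow> nat \<Rightarrow> chart_point \<Rightarrow> nat \<Rightarrow> chart_point \<Rightarrow> bool" where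
  "same_point n j p k q \<longleftrightarrow> (\<exists>c. c \<noteq> 0 \<and>
     (\<forall>a\<le>n. hvec j p a = c * hvec k q a \<and> hcov n k q a = c * hcov n j p a))"

text \<open>The scalar can only be \<open>v k\<close>, because the vector of the second point has
  component 1 at \<open>k\<close>. The base transition then says \<open>v = v k * v'\<close>, and
  the transposed Jacobian says \<open>\<xi>' = v k * \<xi>\<close> away from index \<open>j\<close>.
  The component at \<open>j\<close> follows because both covectors annihilate \<open>v\<close>. From
  here on no derivative occurs, and that gluing is an equivalence relation amounts to inverting and
  multiplying scalars.\<close>

lemma cotangent_gluing_iff:
  assumes jk: "j \<le> n" "k \<le> n" and p: "p \<in> chart_set n j" and q: "q \<in> chart_set n k"
  shows "((j, p), (k, q)) \<in> cotangent_gluing n \<longleftrightarrow> same_point n j p k q"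
proof -
  obtain x y x' y' where xy: "p = (x, y)" "q = (x', y')" by (metis surj_pair)
  have aff: "x \<in> affine_points (chart_index n j)" "y \<in> affine_points (chart_index n j)"
    "x' \<in> affine_points (chart_index n k)" "y' \<in> affine_points (chart_index n k)"
    using p q unfolding xy chart_set_def by auto
  define v \<xi> v' \<xi>' where "v = hvec j p" and "\<xi> = hcov n j p" and "v' = hvec k q" and "\<xi>' = hcov n k q"
  note defs = v_def \<xi>_def v'_def \<xi>'_def
  have vx: "x(j := 1) = v" by (simp add: v_def hvec_def xy)
  have glue: "((j, p), (k, q)) \<in> cotangent_gluing n \<longleftrightarrow> v k \<noteq> 0 \<and> x' = transition n j k x \<and>
     (\<forall>i\<in>chart_index n j. y i = (\<Sum>l\<in>chart_index n k. y' l * transition_jacobian n j k x l i))"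
    unfolding cotangent_gluing_def xy vx[symmetric] using jk aff
    by (auto simp del: fun_upd_apply)
  have trans: "x' = transition n j k x \<longleftrightarrow> (\<forall>a\<le>n. v a = v k * v' a)" if nz: "v k \<noteq> 0"
  proof
    assume eq: "x' = transition n j k x"
    show "\<forall>a\<le>n. v a = v k * v' a"
      using nz by (auto simp: v'_def hvec_def xy eq transition_def chart_index_iff vx)
  next
    assume eq: "\<forall>a\<le>n. v a = v k * v' a"
    show "x' = transition n j k x"
    proof
      fix a
      show "x' a = transition n j k x a"
      proof (cases "a \<in> chart_index n k")
        case True
        then have "a \<le> n" "a \<noteq> k" by (auto simp: chart_index_iff)
        then have "v a = v k * x' a" using eq by (auto simp: v'_def hvec_def xy)
        then show ?thesis using nz True by (simp add: transition_def vx)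
      next
        case False
        then show ?thesis using aff(3) by (auto simp: transition_def affine_points_def PiE_def extensional_def)
      qed
    qed
  qed
  \<comment> \<open>For \<open>i \<noteq> k\<close> only the term \<open>l = i\<close> contributes.
    For \<open>i = k\<close> the diagonal terms are absent, and the terms with
    \<open>v_l / v_k^2\<close> add up to \<open>- (\<Sum> x'_l y'_l) / v_k\<close>, which is the
    dependent component of \<open>\<xi>'\<close> divided by \<open>v_k\<close>.\<close>
  have jac: "(\<Sum>l\<in>chart_index n k. y' l * transition_jacobian n j k x l i) = \<xi>' i / v k"
    if nz: "v k \<noteq> 0" and eq: "\<forall>a\<le>n. v a = v k * v' a" and i: "i \<in> chart_index n j" for i
  proof -
    have "(\<Sum>l\<in>chart_index n k. y' l * transition_jacobian n j k x l i) =
        (\<Sum>l\<in>chart_index n k. of_bool (l = i) * y' i / v k - (x' l * y' l) * (of_bool (i = k) / v k))"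
    proof (rule sum.cong)
      fix l assume l: "l \<in> chart_index n k"
      have "v l = v k * x' l" using eq l by (auto simp: chart_index_iff v'_def hvec_def xy)
      moreover have "transition_jacobian n j k x l i =
          of_bool (l = i) / v k - of_bool (i = k) * v l / v k ^ 2"
        using transition_jacobian_eq[OF i l, of x y] nz unfolding v_def xy by simp
      ultimately show "y' l * transition_jacobian n j k x l i =
          of_bool (l = i) * y' i / v k - (x' l * y' l) * (of_bool (i = k) / v k)"
        using nz by (auto simp: power2_eq_square)
    qed simp
    also have "\<dots> = (\<Sum>l\<in>chart_index n k. of_bool (l = i) * y' i / v k) -
        (\<Sum>l\<in>chart_index n k. x' l * y' l) * (of_bool (i = k) / v k)"
      by (simp only: sum_subtractf sum_distrib_right)
    also have "(\<Sum>l\<in>chart_index n k. of_bool (l = i) * y' i / v k) = of_bool (i \<noteq> k) * y' i / v k"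
    proof (cases "i = k")
      case True
      then show ?thesis by (auto intro!: sum.neutral simp: chart_index_iff)
    next
      case False
      then have "i \<in> chart_index n k" using i by (auto simp: chart_index_iff)
      then show ?thesis using False by (subst sum.remove[of _ i]) (auto intro!: sum.neutral)
    qed
    finally show ?thesis by (auto simp: \<xi>'_def hcov_def xy)
  qed
  show ?thesis
  proof
    assume "((j, p), (k, q)) \<in> cotangent_gluing n"
    then have nz: "v k \<noteq> 0" and "x' = transition n j k x"
      and y: "\<And>i. i \<in> chart_index n j \<Longrightarrow>
        y i = (\<Sum>l\<in>chart_index n k. y' l * transition_jacobian n j k x l i)"
      unfolding glue by simp_all
    then have eq: "\<forall>a\<le>n. v a = v k * v' a" using trans[OF nz] by simp
    have \<xi>: "\<xi>' i = v k * \<xi> i" if "i \<in> chart_index n j" for i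
      using y[OF that] jac[OF nz eq that] nz that by (simp add: \<xi>_def hcov_def xy chart_index_iff)
    have "\<xi>' j = v k * \<xi> j"
    proof -
      have "0 = v k * (\<Sum>a\<le>n. v' a * \<xi>' a)"
        using sum_hvec_hcov[OF jk(2), of q] unfolding defs by simp
      also have "\<dots> = (\<Sum>a\<le>n. v a * \<xi>' a)"
        unfolding sum_distrib_left using eq by (intro sum.cong) auto
      also have "\<dots> = v j * \<xi>' j + (\<Sum>a\<in>{..n} - {j}. v a * \<xi>' a)"
        using jk by (intro sum.remove) auto
      also have "(\<Sum>a\<in>{..n} - {j}. v a * \<xi>' a) = v k * (\<Sum>a\<in>{..n} - {j}. v a * \<xi> a)"
        unfolding sum_distrib_left using \<xi> by (intro sum.cong) (auto simp: chart_index_iff)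
      also have "(\<Sum>a\<in>{..n} - {j}. v a * \<xi> a) = - (v j * \<xi> j)"
        using sum_hvec_hcov[OF jk(1), of p] jk sum.remove[of "{..n}" j "\<lambda>a. v a * \<xi> a"]
        unfolding defs by (simp add: add_eq_0_iff)
      finally show ?thesis by (simp add: v_def)
    qed
    then have "\<forall>a\<le>n. \<xi>' a = v k * \<xi> a" using \<xi> by (metis chart_index_iff)
    then show "same_point n j p k q"
      unfolding same_point_def defs[symmetric] using nz eq by blast
  next
    assume "same_point n j p k q"
    then obtain c where c: "c \<noteq> 0" "\<And>a. a \<le> n \<Longrightarrow> v a = c * v' a" "\<And>a. a \<le> n \<Longrightarrow> \<xi>' a = c * \<xi> a"
      unfolding same_point_def defs[symmetric] by auto
    have ck: "v k = c" using c(2)[OF jk(2)] by (simp add: v'_def)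
    then have nz: "v k \<noteq> 0" and eq: "\<forall>a\<le>n. v a = v k * v' a" using c by auto
    have "y i = (\<Sum>l\<in>chart_index n k. y' l * transition_jacobian n j k x l i)"
      if i: "i \<in> chart_index n j" for i
    proof -
      have "y i = \<xi> i" using i by (simp add: \<xi>_def hcov_def xy chart_index_iff)
      then show ?thesis
        unfolding jac[OF nz eq i] using c(3)[of i] nz i by (simp add: ck chart_index_iff)
    qed
    then show "((j, p), (k, q)) \<in> cotangent_gluing n"
      unfolding glue using nz trans[OF nz] eq by simp
  qed
qed

lemma same_point_refl: "same_point n j p j p"
  unfolding same_point_def by (intro exI[of _ 1]) simp

lemma same_point_sym:
  assumes "same_point n j p k q"
  shows "same_point n k q j p"
proof -
  obtain c where "c \<noteq> 0" "\<forall>a\<le>n. hvec j p a = c * hvec k q a \<and> hcov n k q a = c * hcov n j p a"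
    using assms unfolding same_point_def by auto
  then show ?thesis
    unfolding same_point_def by (intro exI[of _ "inverse c"]) auto
qed

lemma same_point_trans:
  assumes "same_point n j p k q" "same_point n k q l r"
  shows "same_point n j p l r"
proof -
  obtain c where "c \<noteq> 0" "\<forall>a\<le>n. hvec j p a = c * hvec k q a \<and> hcov n k q a = c * hcov n j p a"
    using assms(1) unfolding same_point_def by auto
  moreover obtain d where "d \<noteq> 0" "\<forall>a\<le>n. hvec k q a = d * hvec l r a \<and> hcov n l r a = d * hcov n k q a"
    using assms(2) unfolding same_point_def by auto
  ultimately show ?thesis
    unfolding same_point_def by (intro exI[of _ "c * d"]) auto
qed

lemma cotangent_chart_eq:
  assumes "j \<le> n" "p \<in> chart_set n j"
  shows "cotangent_chart n j p = {(k, q). k \<le> n \<and> q \<in> chart_set n k \<and> same_point n j p k q}"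
proof -
  have valid: "k \<le> n \<and> q \<in> chart_set n k" if "((j, p), (k, q)) \<in> cotangent_gluing n" for k q
    using that unfolding cotangent_gluing_def chart_set_def by auto
  show ?thesis
  proof (rule Set.set_eqI)
    fix kq :: "nat \<times> chart_point"
    obtain k q where kq: "kq = (k, q)" by (rule prod.exhaust)
    show "kq \<in> cotangent_chart n j p \<longleftrightarrow>
        kq \<in> {(k, q). k \<le> n \<and> q \<in> chart_set n k \<and> same_point n j p k q}"
      unfolding kq cotangent_chart_def
      using cotangent_gluing_iff[OF assms(1) _ assms(2), of k q] valid[of k q] by auto
  qed
qed

lemma cotangent_chart_eq_iff:
  assumes "j \<le> n" "p \<in> chart_set n j" "k \<le> n" "q \<in> chart_set n k"
  shows "cotangent_chart n j p = cotangent_chart n k q \<longleftrightarrow> same_point n j p k q"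
proof
  assume "cotangent_chart n j p = cotangent_chart n k q"
  moreover have "(k, q) \<in> cotangent_chart n k q"
    using assms same_point_refl by (simp add: cotangent_chart_eq)
  ultimately have "(k, q) \<in> cotangent_chart n j p" by simp
  then show "same_point n j p k q"
    using assms(1,2) by (simp add: cotangent_chart_eq)
next
  assume *: "same_point n j p k q"
  show "cotangent_chart n j p = cotangent_chart n k q"
    using assms same_point_trans[OF *] same_point_trans[OF same_point_sym[OF *]]
    by (auto simp: cotangent_chart_eq)
qed

text \<open>The moment map \<open>v\<^sub>a \<xi>\<^sub>b\<close> and the affine coordinates \<open>v\<^sub>a / v\<^sub>k\<close> (0 outside \<open>V\<^sub>k\<close>).\<close>

definition moment :: "nat \<Rightarrow> nat \<Rightarrow> nat \<Rightarrow> (nat \<times> chart_point) set \<Rightarrow> complex" where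
  "moment n a b P = (case SOME jp. jp \<in> P of (j, p) \<Rightarrow> hvec j p a * hcov n j p b)"

definition ratio :: "nat \<Rightarrow> nat \<Rightarrow> (nat \<times> chart_point) set \<Rightarrow> complex" where
  "ratio k a P = (case SOME jp. jp \<in> P of (j, p) \<Rightarrow> hvec j p a / hvec j p k)"

lemma representative:
  assumes "j \<le> n" "p \<in> chart_set n j"
  obtains k q where "(SOME jp. jp \<in> cotangent_chart n j p) = (k, q)" "same_point n j p k q"
proof -
  have "(j, p) \<in> cotangent_chart n j p"
    using assms same_point_refl by (simp add: cotangent_chart_eq)
  then have "(SOME jp. jp \<in> cotangent_chart n j p) \<in> cotangent_chart n j p" by (rule someI)
  then show thesis
    using that assms
    by (cases "SOME jp. jp \<in> cotangent_chart n j p") (simp add: cotangent_chart_eq)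
qed

text \<open>Passing to another representative multiplies \<open>v\<close> and \<open>\<xi>\<close>
  by inverse factors, so the choice does not affect the product. For this reason the products
  \<open>v_a \<xi>_b\<close> descend to the bundle, although the separate factors do not.\<close>

lemma moment_chart [simp]:
  assumes jp: "j \<le> n" "p \<in> chart_set n j" and ab: "a \<le> n" "b \<le> n"
  shows "moment n a b (cotangent_chart n j p) = hvec j p a * hcov n j p b"
proof -
  obtain k q where kq: "(SOME jp. jp \<in> cotangent_chart n j p) = (k, q)" "same_point n j p k q"
    using representative[OF jp] by metis
  obtain c where "c \<noteq> 0" "\<forall>a\<le>n. hvec j p a = c * hvec k q a \<and> hcov n k q a = c * hcov n j p a"
    using kq(2) unfolding same_point_def by auto
  then show ?thesis using ab unfolding moment_def kq(1) by simp
qed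

lemma ratio_chart [simp]:
  assumes jp: "j \<le> n" "p \<in> chart_set n j" and ab: "a \<le> n" "b \<le> n"
  shows "ratio b a (cotangent_chart n j p) = hvec j p a / hvec j p b"
proof -
  obtain k q where kq: "(SOME jp. jp \<in> cotangent_chart n j p) = (k, q)" "same_point n j p k q"
    using representative[OF jp] by metis
  obtain c where "c \<noteq> 0" "\<forall>a\<le>n. hvec j p a = c * hvec k q a \<and> hcov n k q a = c * hcov n j p a"
    using kq(2) unfolding same_point_def by auto
  then show ?thesis using ab unfolding ratio_def kq(1) by simp
qed

lemma hvec_polynomial:
  assumes "a \<le> n"
  shows "(\<lambda>p. hvec j p a) \<in> polynomials (chart_coords n j)"
proof (cases "a = j")
  case True
  then show ?thesis using polynomials.const[of 1] by simp
next
  case False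
  then have "(\<lambda>p. hvec j p a) = (\<lambda>(x, y). x a)" by (auto simp: hvec_def)
  then show ?thesis
    using False assms by (auto intro!: polynomials.coord simp: chart_coords_def chart_index_iff)
qed

lemma fibre_polynomial:
  assumes "a \<in> chart_index n j"
  shows "(\<lambda>p. snd p a) \<in> polynomials (chart_coords n j)"
proof -
  have "(\<lambda>p. snd p a) = (\<lambda>(x :: nat \<Rightarrow> complex, y :: nat \<Rightarrow> complex). y a)" by auto
  then show ?thesis
    using assms by (auto intro!: polynomials.coord simp: chart_coords_def)
qed

lemma hcov_polynomial:
  assumes "a \<le> n"
  shows "(\<lambda>p. hcov n j p a) \<in> polynomials (chart_coords n j)"
proof (cases "a = j")
  case True
  have "(\<lambda>p. 0 - (\<Sum>l\<in>chart_index n j. hvec j p l * snd p l)) \<in> polynomials (chart_coords n j)"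
    by (intro polynomials_minus polynomials_sum polynomials.mult hvec_polynomial fibre_polynomial
        polynomials.const) (auto simp: chart_index_iff)
  moreover have "(\<Sum>l\<in>chart_index n j. hvec j p l * snd p l) = (\<Sum>l\<in>chart_index n j. fst p l * snd p l)" for p
    by (intro sum.cong) (auto simp: hvec_def chart_index_iff)
  ultimately show ?thesis using True by (simp add: hcov_def)
next
  case False
  then show ?thesis using fibre_polynomial[of a n j] assms by (simp add: hcov_def chart_index_iff)
qed

subsection \<open>The cotangent bundle as a variety\<close>

lemma regular_space_chart: "regular_space (cotangent_chart_space n j)"
  unfolding cotangent_chart_space_eq by (rule regular_space_embedded)

lemma regular_space_cotangent_bundle: "regular_space (cotangent_bundle n)"
  unfolding cotangent_bundle_def by (rule regular_space_glue) (rule regular_space_chart)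

lemma points_cotangent_bundle:
  "points (cotangent_bundle n) = (\<Union>j\<in>{0..n}. cotangent_chart n j ` chart_set n j)"
  unfolding cotangent_bundle_def points_glue by simp

lemma cotangent_pointE:
  assumes "P \<in> points (cotangent_bundle n)"
  obtains j p where "j \<le> n" "p \<in> chart_set n j" "P = cotangent_chart n j p"
  using assms unfolding points_cotangent_bundle by auto

lemma chart_in_points:
  "j \<le> n \<Longrightarrow> p \<in> chart_set n j \<Longrightarrow> cotangent_chart n j p \<in> points (cotangent_bundle n)"
  unfolding points_cotangent_bundle by auto

lemma morphism_chart:
  "j \<le> n \<Longrightarrow> morphism (cotangent_chart_space n j) (cotangent_bundle n) (cotangent_chart n j)"
  unfolding cotangent_bundle_def by (rule morphism_glue_chart) simp

lemma openin_cotangent_bundle: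
  assumes "U \<subseteq> points (cotangent_bundle n)"
    and "\<And>j. j \<le> n \<Longrightarrow> openin (zariski_topology (chart_coords n j) (chart_set n j))
      {p \<in> chart_set n j. cotangent_chart n j p \<in> U}"
  shows "openin (zar (cotangent_bundle n)) U"
  using assms unfolding cotangent_bundle_def openin_glue points_glue
  by (simp add: cotangent_chart_space_eq)

lemma reg_cotangent_bundleI:
  assumes "\<And>j. j \<le> n \<Longrightarrow> (\<lambda>p. f (cotangent_chart n j p)) \<in>
      reg (cotangent_chart_space n j) {p \<in> chart_set n j. cotangent_chart n j p \<in> U}"
  shows "f \<in> reg (cotangent_bundle n) U"
  using assms unfolding cotangent_bundle_def reg_glue_iff by simp

lemma polynomials_regular_chart:
  assumes "f \<in> polynomials (chart_coords n j)" "openin (zar (cotangent_chart_space n j)) U"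
  shows "f \<in> reg (cotangent_chart_space n j) U"
  using polynomials_regular[OF assms(1)] assms(2) by (simp add: cotangent_chart_space_eq)

lemma moment_regular:
  assumes "a \<le> n" "b \<le> n"
  shows "moment n a b \<in> reg (cotangent_bundle n) (points (cotangent_bundle n))"
proof (rule reg_cotangent_bundleI)
  fix j assume j: "j \<le> n"
  have eq: "{p \<in> chart_set n j. cotangent_chart n j p \<in> points (cotangent_bundle n)} = chart_set n j"
    using chart_in_points[OF j] by auto
  have op: "openin (zar (cotangent_chart_space n j)) (chart_set n j)"
    using openin_topspace[of "zar (cotangent_chart_space n j)"] by simp
  have "(\<lambda>p. hvec j p a * hcov n j p b) \<in> polynomials (chart_coords n j)"
    using assms by (intro polynomials.mult hvec_polynomial hcov_polynomial)
  then have "(\<lambda>p. hvec j p a * hcov n j p b) \<in> reg (cotangent_chart_space n j) (chart_set n j)"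
    using op by (rule polynomials_regular_chart)
  then show "(\<lambda>p. moment n a b (cotangent_chart n j p)) \<in> reg (cotangent_chart_space n j)
      {p \<in> chart_set n j. cotangent_chart n j p \<in> points (cotangent_bundle n)}"
    unfolding eq by (rule regular_space.cong[OF regular_space_chart _ op]) (use j assms in simp)
qed

section \<open>Charts as open affine pieces\<close>

definition chart_image :: "nat \<Rightarrow> nat \<Rightarrow> (nat \<times> chart_point) set set" where
  "chart_image n k = cotangent_chart n k ` chart_set n k"

lemma chart_image_subset: "k \<le> n \<Longrightarrow> chart_image n k \<subseteq> points (cotangent_bundle n)"
  unfolding chart_image_def using chart_in_points by auto

lemma chart_in_chart_image_iff:
  assumes j: "j \<le> n" "p \<in> chart_set n j" and k: "k \<le> n"
  shows "cotangent_chart n j p \<in> chart_image n k \<longleftrightarrow> hvec j p k \<noteq> 0"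
proof
  assume "cotangent_chart n j p \<in> chart_image n k"
  then obtain q where q: "q \<in> chart_set n k" "cotangent_chart n j p = cotangent_chart n k q"
    unfolding chart_image_def by auto
  then have "same_point n j p k q" using cotangent_chart_eq_iff[OF j k q(1)] by simp
  then obtain c where "c \<noteq> 0" "hvec j p k = c * hvec k q k"
    unfolding same_point_def using k by auto
  then show "hvec j p k \<noteq> 0" by simp
next
  assume nz: "hvec j p k \<noteq> 0"
  \<comment> \<open>The representative is rescaled to \<open>v_k = 1\<close>, which divides the
    vector and multiplies the covector by \<open>v_k\<close>. The component \<open>k\<close> of the
    covector is not stored in \<open>q\<close>; it comes out right because the pairing of
    \<open>v\<close> and \<open>\<xi>\<close> is 0.\<close>
  define q :: chart_point where "q = (\<lambda>a\<in>chart_index n k. hvec j p a / hvec j p k,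
    \<lambda>a\<in>chart_index n k. hvec j p k * hcov n j p a)"
  have q: "q \<in> chart_set n k" by (simp add: q_def chart_set_def affine_points_def)
  have vec: "hvec j p a = hvec j p k * hvec k q a" if "a \<le> n" for a
    using that nz by (auto simp: q_def hvec_def[of k] chart_index_iff)
  have cov: "hcov n k q a = hvec j p k * hcov n j p a" if a: "a \<le> n" for a
  proof (cases "a = k")
    case True
    have "hcov n k q k = - (\<Sum>l\<in>chart_index n k. fst q l * snd q l)" by (simp add: hcov_def)
    also have "(\<Sum>l\<in>chart_index n k. fst q l * snd q l) = (\<Sum>l\<in>{..n} - {k}. hvec j p l * hcov n j p l)"
      using nz by (intro sum.cong) (auto simp: q_def chart_index_def)
    also have "\<dots> = - (hvec j p k * hcov n j p k)"
      using sum_hvec_hcov[OF j(1), of p] sum.remove[of "{..n}" k "\<lambda>a. hvec j p a * hcov n j p a"] k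
      by (simp add: add_eq_0_iff)
    finally show ?thesis using True by simp
  next
    case False
    then show ?thesis using a by (simp add: q_def hcov_def[of n k] chart_index_iff)
  qed
  have "same_point n j p k q"
    unfolding same_point_def using nz vec cov by (intro exI[of _ "hvec j p k"]) simp
  then have "cotangent_chart n j p = cotangent_chart n k q"
    using cotangent_chart_eq_iff[OF j k q] by simp
  then show "cotangent_chart n j p \<in> chart_image n k" using q unfolding chart_image_def by auto
qed

lemma preimage_chart_image:
  assumes "j \<le> n" "k \<le> n"
  shows "{p \<in> chart_set n j. cotangent_chart n j p \<in> chart_image n k} =
    {p \<in> chart_set n j. hvec j p k \<noteq> 0}"
  using chart_in_chart_image_iff[OF assms(1) _ assms(2)] by auto

lemma openin_hvec_nonzero:
  assumes "k \<le> n"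
  shows "openin (zariski_topology (chart_coords n j) (chart_set n j)) {p \<in> chart_set n j. hvec j p k \<noteq> 0}"
  using assms by (intro openin_principal hvec_polynomial)

lemma openin_chart_image:
  assumes k: "k \<le> n"
  shows "openin (zar (cotangent_bundle n)) (chart_image n k)"
proof (rule openin_cotangent_bundle[OF chart_image_subset[OF k]])
  fix j assume "j \<le> n"
  then show "openin (zariski_topology (chart_coords n j) (chart_set n j))
      {p \<in> chart_set n j. cotangent_chart n j p \<in> chart_image n k}"
    using k by (simp add: preimage_chart_image openin_hvec_nonzero)
qed

lemma ratio_regular:
  assumes k: "k \<le> n" and a: "a \<le> n"
  shows "ratio k a \<in> reg (cotangent_bundle n) (chart_image n k)"
proof (rule reg_cotangent_bundleI)
  fix j assume j: "j \<le> n"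
  let ?U = "{p \<in> chart_set n j. hvec j p k \<noteq> 0}"
  have op: "openin (zar (cotangent_chart_space n j)) ?U"
    using openin_hvec_nonzero[OF k] by (simp add: cotangent_chart_space_eq)
  have "(\<lambda>p. hvec j p a / hvec j p k) \<in> reg (cotangent_chart_space n j) ?U"
    using op a k
    by (intro regular_space.divide[OF regular_space_chart] polynomials_regular_chart hvec_polynomial) auto
  then show "(\<lambda>p. ratio k a (cotangent_chart n j p)) \<in> reg (cotangent_chart_space n j)
      {p \<in> chart_set n j. cotangent_chart n j p \<in> chart_image n k}"
    unfolding preimage_chart_image[OF j k]
    by (rule regular_space.cong[OF regular_space_chart _ op]) (use j a k in simp)
qed

text \<open>The inverse is read off functions that live on the bundle: as \<open>v_k = 1\<close> in
  chart \<open>k\<close>, \<open>x_a\<close> is \<open>v_a / v_k\<close> and \<open>y_a\<close> is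
  \<open>v_k \<xi>_a\<close>. Both are already known to be regular on the chart image.\<close>

lemma chart_isomorphism:
  assumes k: "k \<le> n"
  shows "isomorphism (cotangent_chart_space n k)
    (open_subspace (cotangent_bundle n) (chart_image n k)) (cotangent_chart n k)"
proof -
  interpret T: regular_space "cotangent_bundle n" by (rule regular_space_cotangent_bundle)
  interpret U: regular_space "open_subspace (cotangent_bundle n) (chart_image n k)"
    by (rule T.regular_space_open_subspace[OF openin_chart_image[OF k]])
  have pts: "points (open_subspace (cotangent_bundle n) (chart_image n k)) = chart_image n k"
    using chart_image_subset[OF k] by auto
  define \<theta> :: "(nat \<times> chart_point) set \<Rightarrow> chart_point" where
    "\<theta> P = (\<lambda>a\<in>chart_index n k. ratio k a P, \<lambda>a\<in>chart_index n k. moment n k a P)" for P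
  have "morphism (open_subspace (cotangent_bundle n) (chart_image n k)) (cotangent_chart_space n k) \<theta>"
    unfolding cotangent_chart_space_eq
  proof (rule U.morphism_into_embedded)
    show "\<theta> P \<in> chart_set n k" for P by (simp add: \<theta>_def chart_set_def affine_points_def)
    fix c assume "c \<in> chart_coords n k"
    then consider i where "i \<in> chart_index n k" "c = (\<lambda>(x, y). x i)"
      | i where "i \<in> chart_index n k" "c = (\<lambda>(x, y). y i)"
      unfolding chart_coords_def by auto
    then show "(\<lambda>P. c (\<theta> P)) \<in> reg (open_subspace (cotangent_bundle n) (chart_image n k))
        (points (open_subspace (cotangent_bundle n) (chart_image n k)))"
    proof cases
      case 1
      then show ?thesis
        using ratio_regular[OF k, of i] unfolding pts by (simp add: \<theta>_def chart_index_iff)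
    next
      case 2
      have "moment n k i \<in> reg (cotangent_bundle n) (chart_image n k)"
        using 2(1) k openin_chart_image[OF k] chart_image_subset[OF k]
        by (intro T.restrict[OF moment_regular]) (auto simp: chart_index_iff)
      then show ?thesis using 2 unfolding pts by (simp add: \<theta>_def)
    qed
  qed
  moreover have \<theta>: "\<theta> (cotangent_chart n k p) = p" if "p \<in> chart_set n k" for p
  proof -
    obtain x y where p: "p = (x, y)" by (rule prod.exhaust)
    have ext: "x \<in> extensional (chart_index n k)" "y \<in> extensional (chart_index n k)"
      using that unfolding p chart_set_def affine_points_def by (auto simp: PiE_def)
    show ?thesis
      unfolding \<theta>_def prod.inject p
    proof
      show "(\<lambda>a\<in>chart_index n k. ratio k a (cotangent_chart n k (x, y))) = x"
        using that k ext(1) unfolding p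
        by (intro extensionalityI[of _ "chart_index n k"]) (auto simp: chart_index_iff hvec_def)
      show "(\<lambda>a\<in>chart_index n k. moment n k a (cotangent_chart n k (x, y))) = y"
        using that k ext(2) unfolding p
        by (intro extensionalityI[of _ "chart_index n k"]) (auto simp: chart_index_iff hcov_def)
    qed
  qed
  moreover have "morphism (cotangent_chart_space n k)
      (open_subspace (cotangent_bundle n) (chart_image n k)) (cotangent_chart n k)"
    by (intro morphism_into_open_subspace morphism_chart k openin_chart_image)
      (simp add: chart_image_def)
  ultimately show ?thesis
    unfolding isomorphism_def pts
    by (intro conjI exI[of _ \<theta>]) (auto simp: chart_image_def)
qed

lemma isomorphism_sym:
  assumes "isomorphism X Y \<phi>"
  obtains \<psi> where "isomorphism Y X \<psi>"
proof -
  obtain \<psi> where "morphism X Y \<phi>" "morphism Y X \<psi>" "\<forall>p\<in>points X. \<psi> (\<phi> p) = p"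
      "\<forall>q\<in>points Y. \<phi> (\<psi> q) = q"
    using assms unfolding isomorphism_def by (elim conjE exE) (rule that)
  then have "isomorphism Y X \<psi>" unfolding isomorphism_def by (intro conjI exI[of _ \<phi>])
  then show thesis by (rule that)
qed

text \<open>The chart is a full affine space. Only its index set, one copy of
  \<open>chart_index n k\<close> for base coordinates and one for fibre coordinates, has to be
  renumbered, so the closed set is everything.\<close>

lemma affine_variety_chart: "affine_variety (cotangent_chart_space n k)"
proof -
  let ?I = "chart_index n k"
  let ?K = "?I <+> ?I"
  define N where "N = card ?K"
  have "finite ?K" by simp
  then obtain e where e: "bij_betw e {..<N} ?K"
    using ex_bij_betw_nat_finite[of ?K] unfolding N_def lessThan_atLeast0 by metis
  define r where "r = inv_into {..<N} e"
  have r: "r z < N" "e (r z) = z" if "z \<in> ?K" for z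
    using bij_betw_apply[OF bij_betw_inv_into[OF e] that] bij_betw_inv_into_right[OF e that]
    unfolding r_def by simp_all
  have rI: "r (Inl a) < N" "e (r (Inl a)) = Inl a" "r (Inr a) < N" "e (r (Inr a)) = Inr a"
    if "a \<in> ?I" for a
    using r[OF InlI[OF that]] r[OF InrI[OF that]] by auto
  have re: "r (e i) = i" if "i < N" for i
    using bij_betw_inv_into_left[OF e, of i] that unfolding r_def by simp
  define d :: "nat \<Rightarrow> chart_point \<Rightarrow> complex" where
    "d i = (case e i of Inl a \<Rightarrow> (\<lambda>(x, y). x a) | Inr a \<Rightarrow> (\<lambda>(x, y). y a))" for i
  define G :: "(nat \<Rightarrow> complex) \<Rightarrow> chart_point" where
    "G v = (\<lambda>a\<in>?I. v (r (Inl a)), \<lambda>a\<in>?I. v (r (Inr a)))" for v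
  have eK: "e i \<in> ?K" if "i < N" for i
    using bij_betw_apply[OF e, of i] that by simp
  show ?thesis
    unfolding cotangent_chart_space_eq
  proof (rule affine_varietyI[where N = N and Z = "affine_points {..<N}" and d = d and G = G])
    show "algebraic_subset N (affine_points {..<N})"
      unfolding algebraic_subset_def
      using closedin_topspace[of "zariski_topology (affine_coords {..<N}) (affine_points {..<N})"] by simp
    show "d i \<in> polynomials (chart_coords n k)" if "i < N" for i
      using eK[OF that] by (auto intro!: polynomials.coord simp: d_def chart_coords_def)
    show "(\<lambda>v. c (G v)) \<in> polynomials (affine_coords {..<N})" if "c \<in> chart_coords n k" for c
    proof -
      have r_poly: "(\<lambda>v. v (r z)) \<in> polynomials (affine_coords {..<N})" if "z \<in> ?K" for z
        using r(1)[OF that] by (auto intro!: polynomials.coord simp: affine_coords_def)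
      consider i where "i \<in> ?I" "c = (\<lambda>(x, y). x i)" | i where "i \<in> ?I" "c = (\<lambda>(x, y). y i)"
        using \<open>c \<in> chart_coords n k\<close> unfolding chart_coords_def by auto
      then show ?thesis
      proof cases
        case (1 i)
        then show ?thesis using r_poly[OF InlI] by (simp add: G_def)
      next
        case (2 i)
        then show ?thesis using r_poly[OF InrI] by (simp add: G_def)
      qed
    qed
    show "(\<lambda>i\<in>{..<N}. d i p) \<in> affine_points {..<N}" for p
      by (simp add: affine_points_def)
    show "G v \<in> chart_set n k" for v
      by (simp add: G_def chart_set_def affine_points_def)
    show "G (\<lambda>i\<in>{..<N}. d i p) = p" if "p \<in> chart_set n k" for p
    proof -
      obtain x y where p: "p = (x, y)" by (rule prod.exhaust)
      have ext: "x \<in> extensional ?I" "y \<in> extensional ?I"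
        using that unfolding p chart_set_def affine_points_def by (auto simp: PiE_def)
      show ?thesis
        unfolding G_def prod.inject p
      proof
        show "(\<lambda>a\<in>?I. (\<lambda>i\<in>{..<N}. d i (x, y)) (r (Inl a))) = x"
          using ext(1) by (intro extensionalityI[of _ ?I]) (auto simp: d_def rI)
        show "(\<lambda>a\<in>?I. (\<lambda>i\<in>{..<N}. d i (x, y)) (r (Inr a))) = y"
          using ext(2) by (intro extensionalityI[of _ ?I]) (auto simp: d_def rI)
      qed
    qed
    show "(\<lambda>i\<in>{..<N}. d i (G v)) = v" if "v \<in> affine_points {..<N}" for v
    proof (rule extensionalityI[of _ "{..<N}"])
      fix i assume "i \<in> {..<N}"
      then have i: "i < N" by simp
      then show "(\<lambda>i\<in>{..<N}. d i (G v)) i = v i"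
        using eK[OF i] re[OF i] by (auto simp: d_def G_def)
    qed (use that in \<open>auto simp: affine_points_def PiE_def\<close>)
  qed
qed

lemma affine_variety_isomorphism:
  assumes "isomorphism X Y \<phi>" "affine_variety Y"
  shows "affine_variety X"
proof -
  obtain N Z \<psi> where "algebraic_subset N Z"
      "isomorphism Y (embedded_space (affine_coords {..<N}) Z) \<psi>"
    using assms(2) unfolding affine_variety_def by (elim exE conjE) (rule that)
  then show ?thesis
    unfolding affine_variety_def using isomorphism_compose[OF assms(1)]
    by (intro exI conjI)
qed

text \<open>Two distinct points either differ in some \<open>v_a \<xi>_b\<close>, and then the
  difference of these global functions is the required \<open>h\<close>, or they lie over different
  points of P^n. In the second case a 2 x 2 minor of their homogeneous coordinates is nonzero, and
  \<open>h\<close> is this minor computed in charts around the two points.\<close>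

lemma separated_cotangent_bundle: "separated (cotangent_bundle n)"
proof (rule separatedI)
  fix N Z f g z
  let ?T = "cotangent_bundle n"
  let ?Z = "embedded_space (affine_coords {..<N}) Z"
  assume f: "morphism ?Z ?T f" and g: "morphism ?Z ?T g" and z: "z \<in> Z" "f z \<noteq> g z"
  interpret Z: regular_space ?Z by (rule regular_space_embedded)
  have fz: "f z \<in> points ?T" and gz: "g z \<in> points ?T"
    using morphism_into[OF f] morphism_into[OF g] z(1) by simp_all
  obtain j p where j: "j \<le> n" "p \<in> chart_set n j" "f z = cotangent_chart n j p"
    using fz by (rule cotangent_pointE)
  obtain k q where k: "k \<le> n" "q \<in> chart_set n k" "g z = cotangent_chart n k q"
    using gz by (rule cotangent_pointE)
  define Wf where "Wf = {z \<in> Z. f z \<in> chart_image n j}"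
  define Wg where "Wg = {z \<in> Z. g z \<in> chart_image n k}"
  have zW: "z \<in> Wf \<inter> Wg" using z(1) j k by (auto simp: Wf_def Wg_def chart_image_def)
  have oW: "openin (zar ?Z) Wf" "openin (zar ?Z) Wg"
    using morphism_openin[OF f openin_chart_image[OF j(1)]] morphism_openin[OF g openin_chart_image[OF k(1)]]
    by (simp_all add: Wf_def Wg_def)
  then have o: "openin (zar ?Z) (Wf \<inter> Wg)" by (rule openin_Int)
  have rf: "(\<lambda>z. ratio j a (f z)) \<in> reg ?Z (Wf \<inter> Wg)" if a: "a \<le> n" for a
  proof (rule Z.restrict[OF _ oW(1) o])
    show "(\<lambda>z. ratio j a (f z)) \<in> reg ?Z Wf"
      using morphism_regular[OF f openin_chart_image[OF j(1)] ratio_regular[OF j(1) a]] by (simp add: Wf_def)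
  qed simp
  have rg: "(\<lambda>z. ratio k a (g z)) \<in> reg ?Z (Wf \<inter> Wg)" if a: "a \<le> n" for a
  proof (rule Z.restrict[OF _ oW(2) o])
    show "(\<lambda>z. ratio k a (g z)) \<in> reg ?Z Wg"
      using morphism_regular[OF g openin_chart_image[OF k(1)] ratio_regular[OF k(1) a]] by (simp add: Wg_def)
  qed simp
  have oT: "openin (zar ?T) (points ?T)" by (rule openin_topspace)
  have oZ: "openin (zar ?Z) Z" using openin_topspace[of "zar ?Z"] by simp
  have full: "{z \<in> Z. f z \<in> points ?T} = Z" "{z \<in> Z. g z \<in> points ?T} = Z"
    using morphism_into[OF f] morphism_into[OF g] by auto
  have mf: "(\<lambda>z. moment n a b (f z)) \<in> reg ?Z (Wf \<inter> Wg)"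
    and mg: "(\<lambda>z. moment n a b (g z)) \<in> reg ?Z (Wf \<inter> Wg)" if ab: "a \<le> n" "b \<le> n" for a b
  proof -
    have "(\<lambda>z. moment n a b (f z)) \<in> reg ?Z Z" "(\<lambda>z. moment n a b (g z)) \<in> reg ?Z Z"
      using morphism_regular[OF f oT moment_regular[OF ab]] morphism_regular[OF g oT moment_regular[OF ab]]
      by (simp_all add: full)
    then show "(\<lambda>z. moment n a b (f z)) \<in> reg ?Z (Wf \<inter> Wg)"
      "(\<lambda>z. moment n a b (g z)) \<in> reg ?Z (Wf \<inter> Wg)"
      using o oZ by (auto intro!: Z.restrict[of _ Z] simp: Wf_def)
  qed
  have conclude: "\<exists>W h. openin (zariski_topology (affine_coords {..<N}) Z) W \<and> z \<in> W \<and>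
      h \<in> reg ?Z W \<and> h z \<noteq> 0 \<and> (\<forall>z\<in>W. f z = g z \<longrightarrow> h z = 0)"
    if "h \<in> reg ?Z (Wf \<inter> Wg)" "h z \<noteq> 0" "\<And>z. z \<in> Wf \<inter> Wg \<Longrightarrow> f z = g z \<Longrightarrow> h z = 0" for h
    using o zW that by (intro exI[of _ "Wf \<inter> Wg"] exI[of _ h]) auto
  show "\<exists>W h. openin (zariski_topology (affine_coords {..<N}) Z) W \<and> z \<in> W \<and>
      h \<in> reg ?Z W \<and> h z \<noteq> 0 \<and> (\<forall>z\<in>W. f z = g z \<longrightarrow> h z = 0)"
  proof (cases "\<exists>a\<le>n. \<exists>b\<le>n. moment n a b (f z) \<noteq> moment n a b (g z)")
    case True
    then obtain a b where ab: "a \<le> n" "b \<le> n" "moment n a b (f z) \<noteq> moment n a b (g z)" by auto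
    show ?thesis
      by (rule conclude[of "\<lambda>z. moment n a b (f z) - moment n a b (g z)"])
        (use ab o mf mg in \<open>auto intro!: Z.minus\<close>)
  next
    case False
    then have M: "hvec j p a * hcov n j p b = hvec k q a * hcov n k q b" if "a \<le> n" "b \<le> n" for a b
      using that j k by auto
    \<comment> \<open>If every minor vanished, then \<open>v = v_k v'\<close> since
      \<open>v'_k = 1\<close>. The equality of the products \<open>v_k \<xi>_b\<close> with
      \<open>v'_k \<xi>'_b\<close> would give \<open>\<xi>' = v_k \<xi>\<close>, and the two points
      would coincide.\<close>
    have "\<exists>a\<le>n. \<exists>b\<le>n. hvec j p a * hvec k q b \<noteq> hvec j p b * hvec k q a"
    proof (rule ccontr)
      assume "\<not> ?thesis"
      then have X: "hvec j p a * hvec k q b = hvec j p b * hvec k q a" if "a \<le> n" "b \<le> n" for a b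
        using that by blast
      have v: "hvec j p a = hvec j p k * hvec k q a" if "a \<le> n" for a
        using X[OF that k(1)] by simp
      have "hvec j p k \<noteq> 0" using v[OF j(1)] by auto
      moreover have "hcov n k q b = hvec j p k * hcov n j p b" if "b \<le> n" for b
        using M[OF k(1) that] by simp
      ultimately have "same_point n j p k q"
        unfolding same_point_def using v by blast
      then show False using z(2) j k cotangent_chart_eq_iff[OF j(1,2) k(1,2)] by simp
    qed
    then obtain a b where ab: "a \<le> n" "b \<le> n" "hvec j p a * hvec k q b \<noteq> hvec j p b * hvec k q a"
      by auto
    have ratio_eq: "ratio k a P = ratio j a P / ratio j k P" if P: "P \<in> points ?T" "P \<in> chart_image n j" "a \<le> n" for P a
    proof -
      obtain l r where l: "l \<le> n" "r \<in> chart_set n l" "P = cotangent_chart n l r"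
        using P(1) by (rule cotangent_pointE)
      have "hvec l r j \<noteq> 0" using P(2) chart_in_chart_image_iff[OF l(1,2) j(1)] l(3) by simp
      then show ?thesis using l j(1) k(1) P(3) by simp
    qed
    \<comment> \<open>The two values are read in possibly different charts, so differences of
      coordinates would not vanish where \<open>f\<close> and \<open>g\<close> agree. The minor
      does, because at a common point the coordinates of chart \<open>k\<close> are those of chart
      \<open>j\<close> up to a common factor.\<close>
    let ?h = "\<lambda>z. ratio j a (f z) * ratio k b (g z) - ratio j b (f z) * ratio k a (g z)"
    show ?thesis
    proof (rule conclude)
      show "?h \<in> reg ?Z (Wf \<inter> Wg)"
        by (intro Z.minus Z.mult o rf rg ab)
      show "?h z \<noteq> 0" using ab j k by simp
      fix y assume y: "y \<in> Wf \<inter> Wg" "f y = g y"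
      have "f y \<in> points ?T" "f y \<in> chart_image n j"
        using morphism_into[OF f, of y] y(1) by (simp_all add: Wf_def)
      then show "?h y = 0" using ratio_eq[of "f y"] ab unfolding y(2) by simp
    qed
  qed
qed

lemma variety_cotangent_bundle: "variety (cotangent_bundle n)"
  unfolding variety_def
proof (intro conjI exI[of _ "chart_image n ` {0..n}"] ballI)
  show "function_sheaf (cotangent_bundle n)"
    by (rule regular_space.sheaf[OF regular_space_cotangent_bundle])
  show "\<Union> (chart_image n ` {0..n}) = points (cotangent_bundle n)"
    unfolding points_cotangent_bundle chart_image_def by simp
  show "separated (cotangent_bundle n)" by (rule separated_cotangent_bundle)
  fix U assume "U \<in> chart_image n ` {0..n}"
  then obtain k where k: "k \<le> n" "U = chart_image n k" by auto
  then show "openin (zar (cotangent_bundle n)) U" using openin_chart_image by simp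
  obtain \<theta> where "isomorphism (open_subspace (cotangent_bundle n) (chart_image n k))
      (cotangent_chart_space n k) \<theta>"
    using chart_isomorphism[OF k(1)] by (rule isomorphism_sym)
  then show "affine_variety (open_subspace (cotangent_bundle n) U)"
    unfolding k(2) by (rule affine_variety_isomorphism) (rule affine_variety_chart)
qed simp

subsection \<open>The toric potential\<close>

text \<open>For \<open>e = n + 1\<close> this is the image of the orbit cell, where
  \<open>v_0 \<xi>_0 + n + 1\<close> equals \<open>u_0 w_0\<close>. The parameter is left free
  because the identity principle uses the same set with \<open>e = 1\<close> as a dense subset of
  \<open>V_0\<close>.\<close>

definition big_cell :: "nat \<Rightarrow> complex \<Rightarrow> (nat \<times> chart_point) set set" where
  "big_cell n e = {P \<in> chart_image n 0. moment n 0 0 P + e \<noteq> 0}"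

lemma big_cell_subset: "big_cell n e \<subseteq> points (cotangent_bundle n)"
  using chart_image_subset[of 0 n] by (auto simp: big_cell_def)

lemma openin_big_cell: "openin (zar (cotangent_bundle n)) (big_cell n e)"
proof -
  interpret T: regular_space "cotangent_bundle n" by (rule regular_space_cotangent_bundle)
  have o: "openin (zar (cotangent_bundle n)) (chart_image n 0)" by (rule openin_chart_image) simp
  have "moment n 0 0 \<in> reg (cotangent_bundle n) (chart_image n 0)"
    using chart_image_subset[of 0 n] by (intro T.restrict[OF moment_regular] o) auto
  then show ?thesis
    unfolding big_cell_def by (intro T.nonzero_open T.add T.const o)
qed

lemma chart_open_dense:
  assumes e: "e \<noteq> 0" and j: "j \<le> n"
  shows "zariski_topology (chart_coords n j) (chart_set n j) closure_of
    {p \<in> chart_set n j. hvec j p 0 * (hvec j p 0 * hcov n j p 0 + e) \<noteq> 0} = chart_set n j"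
proof (rule principal_dense)
  let ?I = "chart_index n j"
  show "(\<lambda>p. hvec j p 0 * (hvec j p 0 * hcov n j p 0 + e)) \<in> polynomials (chart_coords n j)"
    by (intro polynomials.mult polynomials.add polynomials.const hvec_polynomial hcov_polynomial) auto
  fix p assume p: "p \<in> chart_set n j"
  obtain x y where xy: "p = (x, y)" by (rule prod.exhaust)
  \<comment> \<open>A straight segment, so the denominator is 1. It ends at the base point with all
    homogeneous coordinates 1 and at the zero covector. In every chart this gives
    \<open>v_0 = 1\<close> and \<open>\<xi>_0 = 0\<close>, where the polynomial has the value
    \<open>e\<close>.\<close>
  define \<gamma> :: "complex \<Rightarrow> chart_point" where
    "\<gamma> t = (\<lambda>i\<in>?I. x i + t * (1 - x i), \<lambda>i\<in>?I. y i + t * (0 - y i))" for t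
  have ext: "x \<in> extensional ?I" "y \<in> extensional ?I"
    using p unfolding xy chart_set_def affine_points_def by (auto simp: PiE_def)
  have "\<gamma> 0 = p"
    unfolding \<gamma>_def xy using ext by (simp add: extensional_restrict)
  moreover have "hvec j (\<gamma> 1) 0 = 1" "hcov n j (\<gamma> 1) 0 = 0"
    by (auto simp: \<gamma>_def hvec_def hcov_def chart_index_iff intro!: sum.neutral)
  moreover have "\<gamma> t \<in> chart_set n j" for t by (simp add: \<gamma>_def chart_set_def affine_points_def)
  moreover have "\<exists>P. \<forall>t. poly 1 t \<noteq> 0 \<longrightarrow> c (\<gamma> t) * poly 1 t = poly P t" if c: "c \<in> chart_coords n j" for c
  proof -
    consider i where "i \<in> ?I" "c = (\<lambda>(x, y). x i)" | i where "i \<in> ?I" "c = (\<lambda>(x, y). y i)"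
      using c unfolding chart_coords_def by auto
    then show ?thesis
    proof cases
      case 1
      then have "c (\<gamma> t) = poly [:x i, 1 - x i:] t" for t by (simp add: \<gamma>_def)
      then show ?thesis by (intro exI[of _ "[:x i, 1 - x i:]"]) simp
    next
      case 2
      then have "c (\<gamma> t) = poly [:y i, - y i:] t" for t by (simp add: \<gamma>_def)
      then show ?thesis by (intro exI[of _ "[:y i, - y i:]"]) simp
    qed
  qed
  ultimately show "\<exists>\<gamma> D. \<gamma> 0 = p \<and> poly D 0 \<noteq> 0 \<and> poly D 1 \<noteq> 0 \<and>
      hvec j (\<gamma> 1) 0 * (hvec j (\<gamma> 1) 0 * hcov n j (\<gamma> 1) 0 + e) \<noteq> 0 \<and>
      (\<forall>t. poly D t \<noteq> 0 \<longrightarrow> \<gamma> t \<in> chart_set n j) \<and>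
      (\<forall>c\<in>chart_coords n j. \<exists>P. \<forall>t. poly D t \<noteq> 0 \<longrightarrow> c (\<gamma> t) * poly D t = poly P t)"
    using e by (intro exI[of _ \<gamma>] exI[of _ 1]) auto
qed

lemma big_cell_dense:
  assumes e: "e \<noteq> 0"
  shows "zar (cotangent_bundle n) closure_of (big_cell n e) = points (cotangent_bundle n)"
proof (rule antisym[OF closure_of_subset_topspace], rule subsetI)
  fix P assume P: "P \<in> points (cotangent_bundle n)"
  then obtain j p where j: "j \<le> n" "p \<in> chart_set n j" "P = cotangent_chart n j p"
    by (rule cotangent_pointE)
  have "\<exists>Q. Q \<in> big_cell n e \<and> Q \<in> V" if V: "P \<in> V" "openin (zar (cotangent_bundle n)) V" for V
  proof -
    let ?V = "{p \<in> chart_set n j. cotangent_chart n j p \<in> V}"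
    have "openin (zariski_topology (chart_coords n j) (chart_set n j)) ?V"
      using morphism_openin[OF morphism_chart[OF j(1)] V(2)] by (simp add: cotangent_chart_space_eq)
    moreover have "p \<in> ?V" using j V by simp
    moreover have "p \<in> zariski_topology (chart_coords n j) (chart_set n j) closure_of
        {p \<in> chart_set n j. hvec j p 0 * (hvec j p 0 * hcov n j p 0 + e) \<noteq> 0}"
      unfolding chart_open_dense[OF e j(1)] by (rule j(2))
    ultimately have "\<exists>q. q \<in> {p \<in> chart_set n j. hvec j p 0 * (hvec j p 0 * hcov n j p 0 + e) \<noteq> 0} \<and> q \<in> ?V"
      unfolding in_closure_of by meson
    then obtain q where q: "q \<in> chart_set n j" "cotangent_chart n j q \<in> V"
        "hvec j q 0 * (hvec j q 0 * hcov n j q 0 + e) \<noteq> 0"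
      by blast
    then have "cotangent_chart n j q \<in> big_cell n e"
      using chart_in_chart_image_iff[OF j(1) q(1), of 0] j(1) by (simp add: big_cell_def)
    then show ?thesis using q by blast
  qed
  then show "P \<in> zar (cotangent_bundle n) closure_of (big_cell n e)"
    using P unfolding in_closure_of by blast
qed

text \<open>The set where \<open>f\<close> and \<open>g\<close> differ is open. If it were nonempty,
  it would meet the dense set \<open>big_cell n 1\<close>, which lies in \<open>V_0\<close>, where
  the two functions agree. This is the uniqueness behind the definite description of the
  potential.\<close>

lemma regular_eq_on_chart:
  assumes f: "f \<in> reg (cotangent_bundle n) (points (cotangent_bundle n))"
    and g: "g \<in> reg (cotangent_bundle n) (points (cotangent_bundle n))"
    and eq: "\<And>p. p \<in> chart_set n 0 \<Longrightarrow> f (cotangent_chart n 0 p) = g (cotangent_chart n 0 p)"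
    and P: "P \<in> points (cotangent_bundle n)"
  shows "f P = g P"
proof (rule ccontr)
  interpret T: regular_space "cotangent_bundle n" by (rule regular_space_cotangent_bundle)
  let ?W = "{P \<in> points (cotangent_bundle n). f P - g P \<noteq> 0}"
  assume "f P \<noteq> g P"
  then have "P \<in> ?W" using P by simp
  moreover have "openin (zar (cotangent_bundle n)) ?W"
    using f g by (intro T.nonzero_open T.minus openin_topspace)
  ultimately have "?W \<inter> zar (cotangent_bundle n) closure_of (big_cell n 1) \<noteq> {} \<and>
      openin (zar (cotangent_bundle n)) ?W"
    using P big_cell_dense[of 1 n] by auto
  then have "?W \<inter> big_cell n 1 \<noteq> {}"
    using openin_Int_closure_of_eq_empty[of "zar (cotangent_bundle n)" ?W "big_cell n 1"] by simp
  then show False using eq by (auto simp: big_cell_def chart_image_def)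
qed

text \<open>The description is resolved by an explicit candidate built from
  \<open>v_i \<xi>_i\<close>, which is regular everywhere and equals \<open>x_i y_i\<close> on
  \<open>V_0\<close>. Agreement on \<open>V_0\<close> determines it on the bundle, and
  extensionality determines it outside.\<close>

lemma toric_potential_regular_eq:
  shows "toric_potential n c \<in> reg (cotangent_bundle n) (points (cotangent_bundle n))"
    and "p \<in> chart_set n 0 \<Longrightarrow> toric_potential n c (cotangent_chart n 0 p) =
      c - (\<Sum>i=1..n. 2 * of_nat i * fst p i * snd p i)"
proof -
  interpret T: regular_space "cotangent_bundle n" by (rule regular_space_cotangent_bundle)
  let ?P = "\<lambda>h. h \<in> extensional (points (cotangent_bundle n)) \<and>
     h \<in> reg (cotangent_bundle n) (points (cotangent_bundle n)) \<and>
     (\<forall>(x, y)\<in>points (cotangent_chart_space n 0).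
        h (cotangent_chart n 0 (x, y)) = c - (\<Sum>i=1..n. 2 * of_nat i * x i * y i))"
  define h where "h = (\<lambda>P\<in>points (cotangent_bundle n). c - (\<Sum>i=1..n. (2 * of_nat i) * moment n i i P))"
  have "(\<lambda>P. c - (\<Sum>i=1..n. (2 * of_nat i) * moment n i i P)) \<in>
      reg (cotangent_bundle n) (points (cotangent_bundle n))"
    by (intro T.minus T.const T.sum T.mult openin_topspace moment_regular) auto
  then have reg: "h \<in> reg (cotangent_bundle n) (points (cotangent_bundle n))"
    by (rule T.cong[OF _ openin_topspace]) (simp add: h_def)
  have val: "h (cotangent_chart n 0 (x, y)) = c - (\<Sum>i=1..n. 2 * of_nat i * x i * y i)"
    if xy: "(x, y) \<in> chart_set n 0" for x y
  proof -
    have "(\<Sum>i=1..n. (2 * of_nat i) * moment n i i (cotangent_chart n 0 (x, y))) =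
        (\<Sum>i=1..n. 2 * of_nat i * x i * y i)"
      using xy by (intro sum.cong) (auto simp: hvec_def hcov_def)
    then show ?thesis using chart_in_points[OF _ xy] by (simp add: h_def)
  qed
  have "h \<in> extensional (points (cotangent_bundle n))" by (simp add: h_def)
  then have Ph: "?P h" using reg val by auto
  have "h' = h" if h': "?P h'" for h'
  proof (rule extensionalityI[of _ "points (cotangent_bundle n)"])
    show "h' \<in> extensional (points (cotangent_bundle n))" using h' by simp
    show "h \<in> extensional (points (cotangent_bundle n))" by (simp add: h_def)
    show "h' P = h P" if P: "P \<in> points (cotangent_bundle n)" for P
    proof (rule regular_eq_on_chart[OF _ reg _ P])
      show "h' \<in> reg (cotangent_bundle n) (points (cotangent_bundle n))" using h' by simp
      fix p assume "p \<in> chart_set n 0"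
      then show "h' (cotangent_chart n 0 p) = h (cotangent_chart n 0 p)"
        using h' val by (cases p) auto
    qed
  qed
  with Ph have "toric_potential n c = h"
    unfolding toric_potential_def by (rule the_equality)
  then show "toric_potential n c \<in> reg (cotangent_bundle n) (points (cotangent_bundle n))"
    and "p \<in> chart_set n 0 \<Longrightarrow> toric_potential n c (cotangent_chart n 0 p) =
      c - (\<Sum>i=1..n. 2 * of_nat i * fst p i * snd p i)"
    using reg val by (cases p; simp)+
qed

lemma landau_ginzburg_cotangent_bundle:
  "landau_ginzburg (cotangent_bundle n) (toric_potential n c)"
  unfolding landau_ginzburg_def using variety_cotangent_bundle toric_potential_regular_eq(1) by simp

subsection \<open>The birational map\<close>

text \<open>Used twice: it puts \<open>H\<close> into the special linear Lie algebra, and it cancels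
  the contribution of the summand -1 of \<open>u w^T - 1\<close> to the height.\<close>

lemma sum_linear_weights: "(\<Sum>i\<le>n. of_nat n - 2 * of_nat i :: complex) = 0"
proof -
  have "(\<Sum>i\<le>n. of_nat n - 2 * of_nat i :: complex) = (\<Sum>i\<le>n. of_nat n) - 2 * (\<Sum>i\<le>n. of_nat i)"
    by (simp add: sum_subtractf sum_distrib_left)
  also have "2 * (\<Sum>i\<le>n. of_nat i :: complex) = of_nat n * (of_nat n + 1)"
    using double_gauss_sum[of n, where 'a = complex] by (simp add: atLeast0AtMost)
  finally show ?thesis by (simp add: algebra_simps)
qed

lemma mat_trace_mat_diag: "mat_trace (mat_diag m f) = (\<Sum>i<m. f i)"
  by (simp add: mat_trace_def mat_diag_def)

lemma regular_real_diagonal_weights: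
  "regular_real_diagonal (n + 1) (mat_diag (n + 1) (\<lambda>i. of_nat n - 2 * of_nat i))"
  unfolding regular_real_diagonal_def
  by (auto simp: mat_diag_def diagonal_mat_def inj_on_def)

context
  fixes n :: nat
begin

definition minimal_orbit :: "complex mat set" where
  "minimal_orbit = adjoint_orbit (n + 1) (minimal_element n)"

definition orbit_cell :: "complex mat set" where
  "orbit_cell = {A \<in> minimal_orbit. shift A 0 0 \<noteq> 0}"

text \<open>The factors \<open>u\<close> and \<open>w\<close> are not visible on the matrix. Column
  0 of \<open>u w^T\<close> divided by the pivot \<open>u_0 w_0\<close> gives
  \<open>u_i / u_0\<close>, and row 0 gives \<open>u_0 w_i\<close>.\<close>

definition orbit_chart :: "complex mat \<Rightarrow> chart_point" where
  "orbit_chart A = (\<lambda>i\<in>chart_index n 0. shift A i 0 / shift A 0 0, \<lambda>i\<in>chart_index n 0. shift A 0 i)"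

text \<open>Over \<open>V_0\<close>, adding n + 1 to component 0 of the covector raises its pairing
  with \<open>v / v_0\<close> from 0 to n + 1, as the orbit requires. Written with functions on the
  bundle, the map is regular by inspection of its entries.\<close>

definition to_orbit :: "(nat \<times> chart_point) set \<Rightarrow> complex mat" where
  "to_orbit P = orbit_point n (\<lambda>a. ratio 0 a P) (\<lambda>b. moment n 0 b P + of_nat (n + 1) * of_bool (b = 0))"

lemma orbit_chart_in: "orbit_chart A \<in> chart_set n 0"
  by (simp add: orbit_chart_def chart_set_def affine_points_def)

text \<open>The component at 0 is minus the sum of the other products \<open>u_l w_l\<close>. As the
  full pairing is n + 1 here and not 0, it comes out as \<open>u_0 w_0 - (n + 1)\<close>; this is
  the shift that \<open>to_orbit\<close> undoes.\<close>

lemma orbit_chart_coordinates: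
  assumes uw: "(\<Sum>a\<le>n. u a * w a) = of_nat (n + 1)" and nz: "u 0 * w 0 \<noteq> 0" and a: "a \<le> n"
  shows "hvec 0 (orbit_chart (orbit_point n u w)) a = u a / u 0"
    and "hcov n 0 (orbit_chart (orbit_point n u w)) a = u 0 * w a - of_nat (n + 1) * of_bool (a = 0)"
proof -
  have u0: "u 0 \<noteq> 0" "w 0 \<noteq> 0" using nz by auto
  show "hvec 0 (orbit_chart (orbit_point n u w)) a = u a / u 0"
    using u0 a by (auto simp: hvec_def orbit_chart_def chart_index_iff)
  show "hcov n 0 (orbit_chart (orbit_point n u w)) a = u 0 * w a - of_nat (n + 1) * of_bool (a = 0)"
  proof (cases "a = 0")
    case True
    have "(\<Sum>l\<in>chart_index n 0. fst (orbit_chart (orbit_point n u w)) l * snd (orbit_chart (orbit_point n u w)) l) =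
        (\<Sum>l\<in>{..n} - {0}. u l * w l)"
      using u0 by (intro sum.cong) (auto simp: orbit_chart_def chart_index_def)
    also have "\<dots> = of_nat (n + 1) - u 0 * w 0"
      using uw sum.remove[of "{..n}" 0 "\<lambda>a. u a * w a"] by (simp add: algebra_simps)
    finally show ?thesis using True by (simp add: hcov_def)
  next
    case False
    then show ?thesis using a by (simp add: hcov_def orbit_chart_def chart_index_iff)
  qed
qed

lemma orbit_cellE:
  assumes "A \<in> orbit_cell"
  obtains u w where "A = orbit_point n u w" "(\<Sum>a\<le>n. u a * w a) = of_nat (n + 1)" "u 0 * w 0 \<noteq> 0"
proof -
  obtain u w where A: "A = orbit_point n u w" and uw: "(\<Sum>a\<le>n. u a * w a) = of_nat (n + 1)"
    using assms unfolding orbit_cell_def minimal_orbit_def adjoint_orbit_eq by auto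
  moreover have "u 0 * w 0 \<noteq> 0" using assms unfolding orbit_cell_def A by simp
  ultimately show thesis by (rule that)
qed

lemma orbit_point_cong:
  assumes "\<And>a b. a \<le> n \<Longrightarrow> b \<le> n \<Longrightarrow> u a * w b = u' a * w' b"
  shows "orbit_point n u w = orbit_point n u' w'"
  unfolding orbit_point_def by (intro cong_mat) (auto simp: assms)

lemma to_orbit_chart:
  assumes "p \<in> chart_set n 0"
  shows "to_orbit (cotangent_chart n 0 p) =
    orbit_point n (hvec 0 p) (\<lambda>b. hcov n 0 p b + of_nat (n + 1) * of_bool (b = 0))"
  unfolding to_orbit_def by (rule orbit_point_cong) (use assms in simp)

lemma to_orbit_in:
  assumes "p \<in> chart_set n 0"
  shows "to_orbit (cotangent_chart n 0 p) \<in> minimal_orbit"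
proof -
  have "(\<Sum>a\<le>n. hvec 0 p a * (hcov n 0 p a + of_nat (n + 1) * of_bool (a = 0))) =
      (\<Sum>a\<le>n. hvec 0 p a * hcov n 0 p a) + (\<Sum>a\<le>n. of_bool (a = 0) * (hvec 0 p a * of_nat (n + 1)))"
    unfolding sum.distrib[symmetric] by (intro sum.cong) (auto simp: algebra_simps)
  also have "(\<Sum>a\<le>n. of_bool (a = 0) * (hvec 0 p a * of_nat (n + 1))) = of_nat (n + 1)"
    by (subst sum.remove[of _ 0]) (auto intro!: sum.neutral)
  finally have "(\<Sum>a\<le>n. hvec 0 p a * (hcov n 0 p a + of_nat (n + 1) * of_bool (a = 0))) = of_nat (n + 1)"
    using sum_hvec_hcov[of 0 n p] by simp
  then show ?thesis
    unfolding to_orbit_chart[OF assms] minimal_orbit_def by (rule orbit_point_in_orbit)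
qed

lemma to_orbit_orbit_chart:
  assumes "A \<in> orbit_cell"
  shows "to_orbit (cotangent_chart n 0 (orbit_chart A)) = A"
proof -
  obtain u w where A: "A = orbit_point n u w" "(\<Sum>a\<le>n. u a * w a) = of_nat (n + 1)" "u 0 * w 0 \<noteq> 0"
    using assms by (rule orbit_cellE)
  show ?thesis
    unfolding to_orbit_chart[OF orbit_chart_in] A(1)
    by (rule orbit_point_cong) (use A(3) in \<open>simp add: orbit_chart_coordinates[OF A(2,3)] del: of_nat_Suc of_nat_add\<close>)
qed

text \<open>The pivot of the image matrix is \<open>\<xi>_0 + n + 1\<close>, as
  \<open>v_0 = 1\<close>. Its nonvanishing allows \<open>orbit_chart\<close> to divide by
  it.\<close>

lemma orbit_chart_to_orbit:
  assumes p: "p \<in> chart_set n 0" and nz: "hcov n 0 p 0 + of_nat (n + 1) \<noteq> 0"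
  shows "orbit_chart (to_orbit (cotangent_chart n 0 p)) = p"
proof -
  obtain x y where xy: "p = (x, y)" by (rule prod.exhaust)
  have ext: "x \<in> extensional (chart_index n 0)" "y \<in> extensional (chart_index n 0)"
    using p unfolding xy chart_set_def affine_points_def by (auto simp: PiE_def)
  have *: "hvec 0 (x, y) i = x i" "hcov n 0 (x, y) i = y i" if "i \<in> chart_index n 0" for i
    using that by (simp_all add: hvec_def hcov_def chart_index_iff)
  show ?thesis
    unfolding to_orbit_chart[OF p] orbit_chart_def unfolding xy prod.inject
    using ext nz unfolding xy
    by (intro conjI extensionalityI[of _ "chart_index n 0"])
      (simp_all add: * chart_index_iff del: of_nat_Suc of_nat_add)
qed

lemma orbit_chart_in_big_cell:
  assumes "A \<in> orbit_cell"
  shows "cotangent_chart n 0 (orbit_chart A) \<in> big_cell n (of_nat (n + 1))"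
proof -
  obtain u w where A: "A = orbit_point n u w" "(\<Sum>a\<le>n. u a * w a) = of_nat (n + 1)" "u 0 * w 0 \<noteq> 0"
    using assms by (rule orbit_cellE)
  have "moment n 0 0 (cotangent_chart n 0 (orbit_chart A)) + of_nat (n + 1) = u 0 * w 0"
    using orbit_chart_coordinates(2)[OF A(2,3), of 0] orbit_chart_in
    unfolding A(1) by (simp del: of_nat_Suc of_nat_add)
  then show ?thesis
    using A(3) orbit_chart_in unfolding big_cell_def chart_image_def by (simp del: of_nat_Suc of_nat_add)
qed

lemma big_cellE:
  assumes "P \<in> big_cell n e"
  obtains p where "p \<in> chart_set n 0" "P = cotangent_chart n 0 p" "hcov n 0 p 0 + e \<noteq> 0"
proof -
  obtain p where "p \<in> chart_set n 0" "P = cotangent_chart n 0 p" "moment n 0 0 P + e \<noteq> 0"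
    using assms unfolding big_cell_def chart_image_def by auto
  then show thesis using that by simp
qed

lemma openin_orbit_cell: "openin (zar (orbit_variety (n + 1) (minimal_element n))) orbit_cell"
  unfolding orbit_cell_def minimal_orbit_def orbit_variety_def zar_embedded_space
  by (intro openin_principal shift_polynomial) auto

text \<open>Forwards, regularity is checked on the coordinates of \<open>V_0\<close> and then
  composed with the chart; backwards, on matrix entries. Each map lands in the prescribed open set
  because the pivot \<open>shift A 0 0\<close> corresponds to
  \<open>v_0 \<xi>_0 + n + 1\<close>.\<close>

lemma birational_isomorphism:
  "isomorphism (open_subspace (orbit_variety (n + 1) (minimal_element n)) orbit_cell)
    (open_subspace (cotangent_bundle n) (big_cell n (of_nat (n + 1))))
    (cotangent_chart n 0 \<circ> orbit_chart)"
proof -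
  let ?O = "orbit_variety (n + 1) (minimal_element n)"
  let ?T = "cotangent_bundle n"
  let ?B = "big_cell n (of_nat (n + 1))"
  interpret O: regular_space ?O unfolding orbit_variety_def by (rule regular_space_embedded)
  interpret T: regular_space ?T by (rule regular_space_cotangent_bundle)
  interpret OC: regular_space "open_subspace ?O orbit_cell"
    by (rule O.regular_space_open_subspace[OF openin_orbit_cell])
  interpret TB: regular_space "open_subspace ?T ?B"
    by (rule T.regular_space_open_subspace[OF openin_big_cell])
  have ptsO: "points (open_subspace ?O orbit_cell) = orbit_cell"
    by (auto simp: orbit_variety_def orbit_cell_def minimal_orbit_def)
  have ptsT: "points (open_subspace ?T ?B) = ?B"
    using big_cell_subset[of n] by auto
  have shift_reg: "(\<lambda>A. shift A a b) \<in> reg ?O orbit_cell" if "a \<le> n" "b \<le> n" for a b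
    using that openin_orbit_cell unfolding orbit_variety_def
    by (intro polynomials_regular shift_polynomial) auto
  have "morphism (open_subspace ?O orbit_cell) (cotangent_chart_space n 0) orbit_chart"
    unfolding cotangent_chart_space_eq
  proof (rule OC.morphism_into_embedded)
    show "orbit_chart A \<in> chart_set n 0" for A by (rule orbit_chart_in)
    fix c assume "c \<in> chart_coords n 0"
    then consider i where "i \<in> chart_index n 0" "c = (\<lambda>(x, y). x i)"
      | i where "i \<in> chart_index n 0" "c = (\<lambda>(x, y). y i)"
      unfolding chart_coords_def by auto
    then show "(\<lambda>A. c (orbit_chart A)) \<in> reg (open_subspace ?O orbit_cell) (points (open_subspace ?O orbit_cell))"
    proof cases
      case (1 i)
      then have eq: "(\<lambda>A. c (orbit_chart A)) = (\<lambda>A. shift A i 0 / shift A 0 0)" by (simp add: orbit_chart_def)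
      have "(\<lambda>A. shift A i 0 / shift A 0 0) \<in> reg ?O orbit_cell"
        using 1(1) by (intro O.divide openin_orbit_cell shift_reg) (auto simp: orbit_cell_def chart_index_iff)
      then show ?thesis unfolding ptsO eq by simp
    next
      case (2 i)
      then show ?thesis
        unfolding ptsO using shift_reg[of 0 i] by (simp add: orbit_chart_def chart_index_iff)
    qed
  qed
  then have "morphism (open_subspace ?O orbit_cell) ?T (cotangent_chart n 0 \<circ> orbit_chart)"
    by (rule morphism_compose) (rule morphism_chart, simp)
  then have 1: "morphism (open_subspace ?O orbit_cell) (open_subspace ?T ?B) (cotangent_chart n 0 \<circ> orbit_chart)"
    by (rule morphism_into_open_subspace[OF _ openin_big_cell])
      (use orbit_chart_in_big_cell ptsO in auto)
  have rat: "ratio 0 a \<in> reg ?T ?B" if "a \<le> n" for a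
    using that openin_big_cell openin_chart_image[of 0 n]
    by (intro T.restrict[OF ratio_regular]) (auto simp: big_cell_def)
  have mom: "moment n 0 b \<in> reg ?T ?B" if "b \<le> n" for b
    using that openin_big_cell big_cell_subset
    by (intro T.restrict[OF moment_regular]) auto
  have "morphism (open_subspace ?T ?B) (embedded_space (mat_coords (n + 1)) minimal_orbit) to_orbit"
  proof (rule TB.morphism_into_embedded)
    fix P assume "P \<in> points (open_subspace ?T ?B)"
    then have "P \<in> ?B" by (simp only: ptsT)
    then obtain p where "p \<in> chart_set n 0" "P = cotangent_chart n 0 p" by (rule big_cellE)
    then show "to_orbit P \<in> minimal_orbit" using to_orbit_in by simp
  next
    fix c assume "c \<in> mat_coords (n + 1)"
    then obtain a b where ab: "a \<le> n" "b \<le> n" "c = (\<lambda>A. A $$ (a, b))" by (rule mat_coordsE)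
    have "(\<lambda>P. ratio 0 a P * (moment n 0 b P + of_nat (n + 1) * of_bool (b = 0)) - of_bool (a = b)) \<in> reg ?T ?B"
      by (intro T.minus T.mult T.add T.const rat mom ab openin_big_cell)
    then show "(\<lambda>P. c (to_orbit P)) \<in> reg (open_subspace ?T ?B) (points (open_subspace ?T ?B))"
      unfolding ptsT using ab by (simp add: to_orbit_def)
  qed
  then have "morphism (open_subspace ?T ?B) ?O to_orbit"
    unfolding orbit_variety_def minimal_orbit_def .
  then have 2: "morphism (open_subspace ?T ?B) (open_subspace ?O orbit_cell) to_orbit"
  proof (rule morphism_into_open_subspace[OF _ openin_orbit_cell])
    fix P assume "P \<in> points (open_subspace ?T ?B)"
    then have "P \<in> ?B" by (simp only: ptsT)
    then obtain p where p: "p \<in> chart_set n 0" "P = cotangent_chart n 0 p" "hcov n 0 p 0 + of_nat (n + 1) \<noteq> 0"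
      by (rule big_cellE)
    then show "to_orbit P \<in> orbit_cell"
      using to_orbit_in[OF p(1)] by (simp add: orbit_cell_def to_orbit_chart)
  qed
  show ?thesis
    unfolding isomorphism_def ptsO ptsT
  proof (intro conjI exI[of _ to_orbit] 1 2 ballI)
    show "to_orbit ((cotangent_chart n 0 \<circ> orbit_chart) A) = A" if "A \<in> orbit_cell" for A
      using to_orbit_orbit_chart[OF that] by simp
    show "(cotangent_chart n 0 \<circ> orbit_chart) (to_orbit P) = P" if "P \<in> ?B" for P
    proof -
      obtain p where p: "p \<in> chart_set n 0" "P = cotangent_chart n 0 p" "hcov n 0 p 0 + of_nat (n + 1) \<noteq> 0"
        using \<open>P \<in> ?B\<close> by (rule big_cellE)
      show ?thesis unfolding p(2) comp_def orbit_chart_to_orbit[OF p(1,3)] ..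
    qed
  qed
qed

lemma potentials_agree:
  assumes "A \<in> orbit_cell"
  shows "height (mat_diag (n + 1) (\<lambda>i. of_nat n - 2 * of_nat i)) A =
    toric_potential n (of_nat n * of_nat (n + 1)) ((cotangent_chart n 0 \<circ> orbit_chart) A)"
proof -
  let ?l = "\<lambda>i. of_nat n - 2 * of_nat i :: complex"
  obtain u w where A: "A = orbit_point n u w" "(\<Sum>a\<le>n. u a * w a) = of_nat (n + 1)" "u 0 * w 0 \<noteq> 0"
    using assms by (rule orbit_cellE)
  have "height (mat_diag (n + 1) ?l) A = (\<Sum>i<n+1. ?l i * A $$ (i, i))"
    by (rule height_mat_diag) (simp add: A(1))
  also have "\<dots> = (\<Sum>i\<le>n. ?l i * (u i * w i - 1))"
    unfolding A(1) by (intro sum.cong) auto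
  \<comment> \<open>The constant part n of the weight is multiplied by the whole pairing, which
    produces the constant n (n + 1). The part \<open>- 2 i\<close> gives the coefficients of the
    potential.\<close>
  also have "\<dots> = (\<Sum>i\<le>n. of_nat n * (u i * w i) - 2 * of_nat i * (u i * w i) - ?l i)"
    by (intro sum.cong) (auto simp: algebra_simps)
  also have "\<dots> = of_nat n * (\<Sum>i\<le>n. u i * w i) - (\<Sum>i\<le>n. 2 * of_nat i * (u i * w i)) - (\<Sum>i\<le>n. ?l i)"
    by (simp only: sum_subtractf sum_distrib_left)
  also have "\<dots> = of_nat n * of_nat (n + 1) - (\<Sum>i\<le>n. 2 * of_nat i * (u i * w i))"
    unfolding sum_linear_weights A(2) by simp
  \<comment> \<open>Index 0 has no coordinate in \<open>V_0\<close>; its term drops out because its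
    weight is 0.\<close>
  also have "(\<Sum>i\<le>n. 2 * of_nat i * (u i * w i)) = (\<Sum>i=1..n. 2 * of_nat i * (u i * w i))"
    by (rule sum.mono_neutral_right) auto
  also have "\<dots> = (\<Sum>i=1..n. 2 * of_nat i * fst (orbit_chart A) i * snd (orbit_chart A) i)"
    using A(3) unfolding A(1) by (intro sum.cong) (auto simp: orbit_chart_def chart_index_iff)
  finally show ?thesis
    using toric_potential_regular_eq(2)[OF orbit_chart_in] by simp
qed

end

theorem theorem5p4:
  fixes n :: nat
  assumes "n \<ge> 1"
  shows "\<exists>H H0 c. H \<in> sl (n + 1) \<and> H0 \<in> sl (n + 1) \<and>
    H0 = minimal_element n \<and> regular_real_diagonal (n + 1) H \<and>
    birationally_equivalent
      (orbit_variety (n + 1) H0, height H)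
      (cotangent_bundle n, toric_potential n c)"
proof -
  \<comment> \<open>For a traceless diagonal matrix with entries \<open>\<lambda>_i\<close> the
    height is \<open>(n + 1) \<lambda>_0 - \<Sum> (\<lambda>_0 - \<lambda>_i) u_i w_i\<close>.
    Matching the potential asks for \<open>\<lambda>_0 - \<lambda>_i = 2 i\<close>, and trace 0 then
    gives \<open>\<lambda>_0 = n\<close>. The constant n (n + 1) is the height of \<open>H_0\<close>
    itself, which corresponds to x = y = 0.\<close>
  define H where "H = mat_diag (n + 1) (\<lambda>i. of_nat n - 2 * of_nat i :: complex)"
  have "H \<in> sl (n + 1)"
    using sum_linear_weights[of n] unfolding H_def sl_def
    by (simp add: mat_trace_mat_diag lessThan_Suc_atMost del: sum.lessThan_Suc)
  moreover have "minimal_element n \<in> sl (n + 1)"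
    unfolding sl_def minimal_element_def mem_Collect_eq mat_trace_mat_diag
    by (simp add: sum.lessThan_Suc_shift del: sum.lessThan_Suc)
  moreover have "regular_real_diagonal (n + 1) H"
    unfolding H_def by (rule regular_real_diagonal_weights)
  moreover have "birationally_equivalent (orbit_variety (n + 1) (minimal_element n), height H)
      (cotangent_bundle n, toric_potential n (of_nat n * of_nat (n + 1)))"
    unfolding birationally_equivalent_def prod.case
  proof (intro conjI exI)
    show "landau_ginzburg (orbit_variety (n + 1) (minimal_element n)) (height H)"
      unfolding H_def by (rule landau_ginzburg_orbit)
    show "landau_ginzburg (cotangent_bundle n) (toric_potential n (of_nat n * of_nat (n + 1)))"
      by (rule landau_ginzburg_cotangent_bundle)
    show "openin (zar (orbit_variety (n + 1) (minimal_element n))) (orbit_cell n)"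
      by (rule openin_orbit_cell)
    show "zar (orbit_variety (n + 1) (minimal_element n)) closure_of (orbit_cell n) =
        points (orbit_variety (n + 1) (minimal_element n))"
      using orbit_open_dense[of n] by (simp add: orbit_variety_def orbit_cell_def minimal_orbit_def)
    show "openin (zar (cotangent_bundle n)) (big_cell n (of_nat (n + 1)))"
      by (rule openin_big_cell)
    show "zar (cotangent_bundle n) closure_of (big_cell n (of_nat (n + 1))) = points (cotangent_bundle n)"
      by (rule big_cell_dense) (simp del: of_nat_Suc of_nat_add)
    show "isomorphism (open_subspace (orbit_variety (n + 1) (minimal_element n)) (orbit_cell n))
        (open_subspace (cotangent_bundle n) (big_cell n (of_nat (n + 1))))
        (cotangent_chart n 0 \<circ> orbit_chart n)"
      by (rule birational_isomorphism)
    show "\<forall>A\<in>orbit_cell n. height H A =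
        toric_potential n (of_nat n * of_nat (n + 1)) ((cotangent_chart n 0 \<circ> orbit_chart n) A)"
      unfolding H_def using potentials_agree by blast
  qed
  ultimately show ?thesis by blast
qed

end
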